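(* For any infinite, simple, connected graph $G$ of bounded vertex degree, there exist $k>0$ and a proper edge-coloring of $G$ with $k$ colors such that every uniformly recurrent subgroup of $\Gamma_k$ obtained from this edge-colored graph (that is, every $(S^A_{\Gamma_k})^{-1}(M)\subset\mathrm{Sub}(\Gamma_k)$, where $M$ is a minimal subsystem of the orbit closure $X$ of the rooted Schreier graph $(S,x)$ determined by the colored graph) is generic.
   Context: $\Gamma_k$ is the $k$-fold free product of cyclic groups of order $2$ with free generators $A=\{a_1,\dots,a_k\}$. For a group $\Gamma$, $\mathrm{Sub}(\Gamma)$ is the compact space of subgroups, with $\Gamma$ acting by conjugation; a uniformly recurrent subgroup (URS) is a nonempty closed invariant $Z\subset\mathrm{Sub}(\Gamma)$ on which the action is minimal. A URS $Z$ is generic if for every $H\in Z$ the map $\Gamma/H\to\mathrm{Orb}(H)$, $gH\mapsto gHg^{-1}$, is a bijection, i.e. every $H\in Z$ is self-normalizing. For $H\in\mathrm{Sub}(\Gamma_k)$, $S^A_{\Gamma_k}(H)$ is the rooted Schreier graph with vertex set $\Gamma_k/H$, root $H$, and edges labeled $a_i$ between $aH$ and $bH$ when $a_iaH=bH$. $\mathrm{Sch}^A_{\Gamma_k}$ is the compact metric space of all rooted Schreier graphs (two are at distance $2^{-r}$ if $r$ is the largest integer for which the $r$-balls around the roots are rooted-labeled isomorphic); $\Gamma_k$ acts on it by changing the root ($\gamma$ moves the root $x$ to $\gamma x$), and $S^A_{\Gamma_k}:\mathrm{Sub}(\Gamma_k)\to\mathrm{Sch}^A_{\Gamma_k}$ is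 an equivariant homeomorphism. Construction: given a proper edge-coloring of an infinite simple connected bounded degree graph $G$ by colors $c_1,\dots,c_k$, $\Gamma_k$ acts on $V(G)$ by: $a_i(x)=y$ if there is an edge $(x,y)$ colored $c_i$, and $a_i(x)=x$ if there is no $c_i$-colored edge adjacent to $x$. Picking a root $x\in V(G)$ gives a rooted $\Gamma_k$-Schreier graph $(S,x)$. Let $X$ be its orbit closure in $\mathrm{Sch}^A_{\Gamma_k}$; for any minimal subsystem $M\subset X$, $(S^A_{\Gamma_k})^{-1}(M)$ is a URS of $\Gamma_k$. *)

theory Defs
  imports
    "HOL-Analysis.Analysis"
    "HOL-Algebra.Left_Coset"
    "HOL-Algebra.Group_Action"
begin

section \<open>The free product of k cyclic groups of order two\<close>

text \<open>
  The free generators are indexed by the natural numbers below k.  An element of the free product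
  is represented by its normal form, a word without two equal consecutive letters; multiplication is
  concatenation followed by cancellation.
\<close>

definition lmul :: "nat \<Rightarrow> nat list \<Rightarrow> nat list" where
  "lmul a w = (case w of [] \<Rightarrow> [a] | b # u \<Rightarrow> if a = b then u else a # w)"

definition Gamma_group :: "nat \<Rightarrow> nat list monoid" where
  "Gamma_group k = \<lparr>carrier = {w. set w \<subseteq> {..<k} \<and> distinct_adj w},
              mult = (\<lambda>u v. foldr lmul u v), one = []\<rparr>"

definition gen :: "nat \<Rightarrow> nat list" where
  "gen i = [i]"

lemma lmul_closed:
  assumes "distinct_adj w" shows "distinct_adj (lmul a w)"
  using assms by (auto simp: lmul_def distinct_adj_Cons split: list.splits)

lemma lmul_lmul:
  assumes "distinct_adj w" shows "lmul a (lmul a w) = w"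
  using assms by (auto simp: lmul_def distinct_adj_Cons split: list.splits)

lemma set_lmul: "set (lmul a w) \<subseteq> insert a (set w)"
  by (auto simp: lmul_def split: list.splits if_splits)

lemma foldr_lmul_closed:
  assumes "distinct_adj w" shows "distinct_adj (foldr lmul u w)"
  using assms by (induction u) (auto intro: lmul_closed)

lemma set_foldr_lmul: "set (foldr lmul u w) \<subseteq> set u \<union> set w"
proof (induction u)
  case (Cons a u)
  then show ?case using set_lmul[of a "foldr lmul u w"] by auto
qed simp

lemma foldr_lmul_lmul:
  assumes "distinct_adj w" shows "foldr lmul (lmul a v) w = lmul a (foldr lmul v w)"
proof (cases v)
  case (Cons b v')
  then show ?thesis
    using lmul_lmul[OF foldr_lmul_closed[OF assms, of v']] by (auto simp: lmul_def[of a "b # v'"])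
qed (simp add: lmul_def[of a "[]"])

lemma foldr_lmul_assoc:
  assumes "distinct_adj w"
  shows "foldr lmul (foldr lmul u v) w = foldr lmul u (foldr lmul v w)"
  by (induction u) (simp_all add: foldr_lmul_lmul[OF assms])

lemma foldr_lmul_Nil:
  assumes "distinct_adj w" shows "foldr lmul w [] = w"
  using assms
proof (induction w)
  case (Cons a w)
  then have "foldr lmul w [] = w" by (auto dest: distinct_adj_ConsD)
  then have "foldr lmul (a # w) [] = lmul a w" by simp
  also have "\<dots> = a # w" using Cons.prems by (cases w) (auto simp: lmul_def)
  finally show ?case .
qed simp

lemma foldr_lmul_rev:
  assumes "distinct_adj w" shows "foldr lmul (rev u) (foldr lmul u w) = w"
  using assms
  by (induction u) (simp_all add: lmul_lmul foldr_lmul_closed)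

lemma group_Gamma_group: "group (Gamma_group k)"
proof (rule groupI)
  fix x assume x: "x \<in> carrier (Gamma_group k)"
  then have "foldr lmul (rev x) x = []"
    using foldr_lmul_rev[of "[]" x] foldr_lmul_Nil[of x] by (simp add: Gamma_group_def)
  then show "\<exists>y\<in>carrier (Gamma_group k). y \<otimes>\<^bsub>Gamma_group k\<^esub> x = \<one>\<^bsub>Gamma_group k\<^esub>"
    using x by (intro bexI[of _ "rev x"]) (simp_all add: Gamma_group_def)
next
  fix x y assume "x \<in> carrier (Gamma_group k)" "y \<in> carrier (Gamma_group k)"
  then show "x \<otimes>\<^bsub>Gamma_group k\<^esub> y \<in> carrier (Gamma_group k)"
    using set_foldr_lmul[of x y] by (auto simp: Gamma_group_def intro: foldr_lmul_closed)
qed (auto simp: Gamma_group_def foldr_lmul_assoc)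


section \<open>Minimal subsystems and uniformly recurrent subgroups\<close>

definition minimal_subsystem ::
    "('g, 'b) monoid_scheme \<Rightarrow> 'x topology \<Rightarrow> ('g \<Rightarrow> 'x \<Rightarrow> 'x) \<Rightarrow> 'x set \<Rightarrow> bool" where
  "minimal_subsystem G T act M \<longleftrightarrow>
     M \<noteq> {} \<and> closedin T M \<and> (\<forall>g\<in>carrier G. act g ` M \<subseteq> M) \<and>
     (\<forall>N. N \<subseteq> M \<and> N \<noteq> {} \<and> closedin T N \<and> (\<forall>g\<in>carrier G. act g ` N \<subseteq> N) \<longrightarrow> N = M)"

definition Sub :: "('g, 'b) monoid_scheme \<Rightarrow> 'g set set" where
  "Sub G = {H. subgroup H G}"

text \<open>
  The topology that \<open>Sub G\<close> inherits from the product space of all 0-1 functions on G, a subgroup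
  being identified with its indicator function.
\<close>

definition Sub_topology :: "('g, 'b) monoid_scheme \<Rightarrow> 'g set topology" where
  "Sub_topology G =
     pullback_topology (Sub G) (\<lambda>H. \<lambda>g\<in>carrier G. g \<in> H)
       (product_topology (\<lambda>_. discrete_topology (UNIV :: bool set)) (carrier G))"

definition conj_act :: "('g, 'b) monoid_scheme \<Rightarrow> 'g \<Rightarrow> 'g set \<Rightarrow> 'g set" where
  "conj_act G g H = g <#\<^bsub>G\<^esub> H #>\<^bsub>G\<^esub> (inv\<^bsub>G\<^esub> g)"

definition URS :: "('g, 'b) monoid_scheme \<Rightarrow> 'g set set \<Rightarrow> bool" where
  "URS G Z \<longleftrightarrow> minimal_subsystem G (Sub_topology G) (conj_act G) Z"

text \<open>
  For a left coset C = gH all the conjugates of H by elements of C coincide with the conjugate of H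
  by g, so their union is the value at C of the map from left cosets to the conjugation orbit.
\<close>

definition coset_conj :: "('g, 'b) monoid_scheme \<Rightarrow> 'g set \<Rightarrow> 'g set \<Rightarrow> 'g set" where
  "coset_conj G H C = (\<Union>g\<in>C. conj_act G g H)"

definition generic_URS :: "('g, 'b) monoid_scheme \<Rightarrow> 'g set set \<Rightarrow> bool" where
  "generic_URS G Z \<longleftrightarrow>
     URS G Z \<and> (\<forall>H\<in>Z. bij_betw (coset_conj G H) (lcosets\<^bsub>G\<^esub> H) (orbit G (conj_act G) H))"

lemma (in group) conj_act_mult:
  assumes "subgroup H G" "x \<in> carrier G" "y \<in> carrier G"
  shows "conj_act G (x \<otimes> y) H = conj_act G x (conj_act G y H)"
proof -
  have H: "H \<subseteq> carrier G" using assms(1) by (rule subgroup.subset)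
  have "conj_act G (x \<otimes> y) H = (x <# (y <# H)) #> (inv y \<otimes> inv x)"
    using assms H by (simp add: conj_act_def lcos_m_assoc inv_mult_group)
  also have "\<dots> = x <# (y <# H) #> inv y #> inv x"
    using assms H by (simp add: coset_mult_assoc l_coset_subset_G)
  also have "x <# (y <# H) #> inv y = x <# (y <# H #> inv y)"
    using assms H by (simp add: coset_assoc l_coset_subset_G)
  finally show ?thesis by (simp add: conj_act_def)
qed

lemma (in group) coset_conj_eq:
  assumes H: "subgroup H G" and g: "g \<in> carrier G"
  shows "coset_conj G H (g <# H) = conj_act G g H"
proof -
  interpret H: subgroup H G by (rule H)
  have "conj_act G (g \<otimes> h) H = conj_act G g H" if h: "h \<in> H" for h
  proof -
    have "h <# H = H" using h H by (metis coset_join3 H.mem_carrier)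
    moreover have "H #> inv h = H" using h H by (simp add: coset_join2)
    ultimately have "conj_act G h H = H" by (simp add: conj_act_def)
    then show ?thesis using conj_act_mult[OF H g, of h] h by simp
  qed
  moreover have "H \<noteq> {}" using H.one_closed by blast
  ultimately show ?thesis by (auto simp: coset_conj_def l_coset_def)
qed


section \<open>The space of rooted Schreier graphs\<close>

text \<open>
  \<open>(x, i, y) \<in> rl_edges R\<close> stands for an edge (a loop if x = y) labeled by the i-th generator between
  x and y; as the generators are involutions, this relation is symmetric in x and y for
  Schreier graphs.
\<close>

record 'v rlgraph =
  rl_verts :: "'v set"
  rl_edges :: "('v \<times> nat \<times> 'v) set"
  rl_root :: 'v

definition wf_rlgraph :: "'v rlgraph \<Rightarrow> bool" where
  "wf_rlgraph R \<longleftrightarrow> rl_root R \<in> rl_verts R \<and> rl_edges R \<subseteq> rl_verts R \<times> UNIV \<times> rl_verts R"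

definition rl_iso :: "'v rlgraph \<Rightarrow> 'w rlgraph \<Rightarrow> bool" where
  "rl_iso R R' \<longleftrightarrow>
     (\<exists>f. bij_betw f (rl_verts R) (rl_verts R') \<and> f (rl_root R) = rl_root R' \<and>
          (\<forall>x\<in>rl_verts R. \<forall>y\<in>rl_verts R. \<forall>i. (x, i, y) \<in> rl_edges R \<longleftrightarrow> (f x, i, f y) \<in> rl_edges R'))"

definition schreier_graph :: "nat \<Rightarrow> nat list set \<Rightarrow> nat list set rlgraph" where
  "schreier_graph k H =
     \<lparr>rl_verts = lcosets\<^bsub>Gamma_group k\<^esub> H,
      rl_edges = {(C, i, gen i <#\<^bsub>Gamma_group k\<^esub> C) | C i. C \<in> lcosets\<^bsub>Gamma_group k\<^esub> H \<and> i < k},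
      rl_root = H\<rparr>"

text \<open>
  Rooted Schreier graphs are considered up to rooted-labeled isomorphism.  The isomorphism class of a
  graph with an arbitrary vertex type is represented by its members whose vertices belong to the
  type of the cosets in \<open>Gamma_group k\<close>; it is never empty for a Schreier graph, because every rooted
  Schreier graph is isomorphic to the \<open>schreier_graph\<close> of the stabilizer of its root.
\<close>

definition sch_class :: "'v rlgraph \<Rightarrow> nat list set rlgraph set" where
  "sch_class R = {R'. wf_rlgraph R' \<and> rl_iso R R'}"

definition SchreierMap :: "nat \<Rightarrow> nat list set \<Rightarrow> nat list set rlgraph set" where
  "SchreierMap k H = sch_class (schreier_graph k H)"

definition Sch :: "nat \<Rightarrow> nat list set rlgraph set set" where
  "Sch k = SchreierMap k ` Sub (Gamma_group k)"

text \<open>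
  The ball of radius r consists of the vertices and edges on walks of length at most r from the root.
  In particular the ball of radius 0 is the root without its loops, so that balls of radius 0 are
  always isomorphic and the largest radius in the definition of the distance exists for distinct
  points.
\<close>

primrec reach :: "'v rlgraph \<Rightarrow> nat \<Rightarrow> 'v set" where
  "reach R 0 = {rl_root R}"
| "reach R (Suc r) = reach R r \<union> {y. \<exists>x\<in>reach R r. \<exists>i. (x, i, y) \<in> rl_edges R}"

definition rl_ball :: "'v rlgraph \<Rightarrow> nat \<Rightarrow> 'v rlgraph" where
  "rl_ball R r =
     \<lparr>rl_verts = reach R r,
      rl_edges = {(x, i, y) \<in> rl_edges R. \<exists>s<r. x \<in> reach R s \<or> y \<in> reach R s},
      rl_root = rl_root R\<rparr>"

definition sch_dist :: "nat list set rlgraph set \<Rightarrow> nat list set rlgraph set \<Rightarrow> real" where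
  "sch_dist P Q =
     (if P = Q then 0
      else (1/2) ^ (GREATEST r. \<exists>R\<in>P. \<exists>R'\<in>Q. rl_iso (rl_ball R r) (rl_ball R' r)))"

definition Sch_topology :: "nat \<Rightarrow> nat list set rlgraph set topology" where
  "Sch_topology k = Metric_space.mtopology (Sch k) sch_dist"

text \<open>A word acts on the vertices by following its letters from right to left.\<close>

definition neighbour :: "'v rlgraph \<Rightarrow> nat \<Rightarrow> 'v \<Rightarrow> 'v" where
  "neighbour R i x = (THE y. (x, i, y) \<in> rl_edges R)"

definition move_root :: "nat list \<Rightarrow> 'v rlgraph \<Rightarrow> 'v rlgraph" where
  "move_root g R = R\<lparr>rl_root := foldr (neighbour R) g (rl_root R)\<rparr>"

definition sch_act :: "nat list \<Rightarrow> nat list set rlgraph set \<Rightarrow> nat list set rlgraph set" where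
  "sch_act g P = move_root g ` P"


section \<open>Edge-colored graphs\<close>

definition simple_graph :: "'a set \<Rightarrow> 'a set set \<Rightarrow> bool" where
  "simple_graph V E \<longleftrightarrow> (\<forall>e\<in>E. \<exists>x\<in>V. \<exists>y\<in>V. x \<noteq> y \<and> e = {x, y})"

definition connected_graph :: "'a set \<Rightarrow> 'a set set \<Rightarrow> bool" where
  "connected_graph V E \<longleftrightarrow> (\<forall>x\<in>V. \<forall>y\<in>V. (x, y) \<in> {(u, v). {u, v} \<in> E}\<^sup>*)"

definition bounded_degree :: "'a set \<Rightarrow> 'a set set \<Rightarrow> bool" where
  "bounded_degree V E \<longleftrightarrow> (\<exists>d. \<forall>x\<in>V. finite {e \<in> E. x \<in> e} \<and> card {e \<in> E. x \<in> e} \<le> d)"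

definition proper_edge_coloring :: "'a set set \<Rightarrow> nat \<Rightarrow> ('a set \<Rightarrow> nat) \<Rightarrow> bool" where
  "proper_edge_coloring E k c \<longleftrightarrow>
     c ` E \<subseteq> {..<k} \<and> (\<forall>e\<in>E. \<forall>e'\<in>E. e \<noteq> e' \<and> e \<inter> e' \<noteq> {} \<longrightarrow> c e \<noteq> c e')"

definition color_act :: "'a set set \<Rightarrow> ('a set \<Rightarrow> nat) \<Rightarrow> nat \<Rightarrow> 'a \<Rightarrow> 'a" where
  "color_act E c i x =
     (if \<exists>y. {x, y} \<in> E \<and> c {x, y} = i then (THE y. {x, y} \<in> E \<and> c {x, y} = i) else x)"

definition colored_schreier_graph ::
    "'a set \<Rightarrow> 'a set set \<Rightarrow> nat \<Rightarrow> ('a set \<Rightarrow> nat) \<Rightarrow> 'a \<Rightarrow> 'a rlgraph" where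
  "colored_schreier_graph V E k c x =
     \<lparr>rl_verts = V, rl_edges = {(v, i, color_act E c i v) | v i. v \<in> V \<and> i < k}, rl_root = x\<rparr>"

definition orbit_closure ::
    "'a set \<Rightarrow> 'a set set \<Rightarrow> nat \<Rightarrow> ('a set \<Rightarrow> nat) \<Rightarrow> 'a \<Rightarrow> nat list set rlgraph set set" where
  "orbit_closure V E k c x =
     Abstract_Topology.closure_of (Sch_topology k)
       (orbit (Gamma_group k) sch_act (sch_class (colored_schreier_graph V E k c x)))"

end

theory Submission
  imports Defs
begin

text \<open>
  Colour the vertices with finitely many colours so that no path of the square of G has a colour word
  of the form uu, and give an edge the unordered pair of the colours of its ends.  If H in a URS of
  this coloured graph is normalized by an element outside H, then the Schreier graph of H has a
  nontrivial automorphism.  A shortest path from a vertex to its image, among all vertices and all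
  such automorphisms, followed by its own image, is a path that reads some word twice.  Balls of the
  Schreier graph occur in G, and the edge colours determine the vertex colours, so that G has a path
  with a colour word uu.
\<close>

section \<open>Nonrepetitive colourings of graphs of bounded degree\<close>

text \<open>A point of the orbit closure has edge labels but no vertex colours, and it is only a
  limit of rerootings of G. So the nonrepetitive colouring must be readable from edge labels, and
  the contradiction must take place inside one finite ball. The square of G is coloured so that two
  neighbours of a common vertex differ: this makes the unordered pairs a proper edge colouring, and
  it is needed again when vertex colours are read off from the labels. Nonrepetitiveness can only be
  asked of paths with pairwise distinct vertices, since going back and forth along an edge always
  repeats. Hence the doubled path has to be injective, which is why the displacement is minimized
  over all vertices and all nontrivial automorphisms at once. Genericity is reached through
  normalizers: two cosets aH and bH give the same conjugate exactly when the inverse of b times a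
  normalizes H, and an element of the normalizer outside H moves the root by a nontrivial
  automorphism of the Schreier graph.\<close>

lemma openin_product_discrete:
  assumes F: "finite F" "F \<subseteq> I" and A: "A \<subseteq> (I \<rightarrow>\<^sub>E U)"
    and dep: "\<And>f g. f \<in> A \<Longrightarrow> g \<in> (I \<rightarrow>\<^sub>E U) \<Longrightarrow> (\<And>i. i \<in> F \<Longrightarrow> g i = f i) \<Longrightarrow> g \<in> A"
  shows "openin (product_topology (\<lambda>_. discrete_topology U) I) A"
proof (subst openin_subopen, intro ballI)
  fix f assume f: "f \<in> A"
  then have fU: "f i \<in> U" if "i \<in> I" for i using A that by auto
  let ?B = "Pi\<^sub>E I (\<lambda>i. if i \<in> F then {f i} else U)"
  have "openin (product_topology (\<lambda>_. discrete_topology U) I) ?B"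
  proof (rule product_topology_basis)
    show "openin (discrete_topology U) (if i \<in> F then {f i} else U)" for i
      using fU F by auto
    have "{i. (if i \<in> F then {f i} else U) \<noteq> topspace (discrete_topology U)} \<subseteq> F" by auto
    then show "finite {i. (if i \<in> F then {f i} else U) \<noteq> topspace (discrete_topology U)}"
      using F(1) finite_subset by blast
  qed
  moreover have "f \<in> ?B" using f A fU by (auto simp: PiE_iff)
  moreover have "?B \<subseteq> A"
  proof
    fix g assume g: "g \<in> ?B"
    show "g \<in> A"
    proof (rule dep[OF f])
      show "g i = f i" if "i \<in> F" for i using PiE_mem[OF g, of i] F that by auto
      have "g i \<in> U" if "i \<in> I" for i using PiE_mem[OF g that] fU[OF that] by (auto split: if_splits)
      then show "g \<in> (I \<rightarrow>\<^sub>E U)" using g by (simp add: PiE_iff)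
    qed
  qed
  ultimately show "\<exists>T. openin (product_topology (\<lambda>_. discrete_topology U) I) T \<and> f \<in> T \<and> T \<subseteq> A"
    by blast
qed

definition repetitive :: "('a \<Rightarrow> 'b) \<Rightarrow> 'a list \<Rightarrow> bool" where
  "repetitive f p \<longleftrightarrow> (\<exists>xs. xs \<noteq> [] \<and> map f p = xs @ xs)"

lemma repetitive_append:
  assumes "repetitive f p"
  obtains xs ys where "p = xs @ ys" "length xs = length ys" "xs \<noteq> []" "map f xs = map f ys"
proof -
  obtain zs where zs: "zs \<noteq> []" "map f p = zs @ zs" using assms by (auto simp: repetitive_def)
  from zs(2) obtain xs ys where xy: "p = xs @ ys" "zs = map f xs" "zs = map f ys"
    unfolding map_eq_append_conv by blast
  moreover from xy(2,3) have "length xs = length ys" by (metis length_map)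
  ultimately show thesis using zs(1) that[of xs ys] by auto
qed

lemma repetitive_cong: "(\<And>x. x \<in> set p \<Longrightarrow> f x = g x) \<Longrightarrow> repetitive f p = repetitive g p"
  by (simp add: repetitive_def cong: map_cong)

text \<open>Only the resulting bound 2 matters; it turns a factor 4 D into the summand 8 D of
  \<open>num_colors\<close>.\<close>

lemma sum_nat_div_power2: "(\<Sum>n\<le>m. real n / 2 ^ n) = 2 - (real m + 2) / 2 ^ m"
  by (induction m) (simp_all add: field_simps)

text \<open>Neighbourhoods instead of an edge set, so that the square of a graph can be substituted
  directly. A vertex may be its own neighbour, as happens in that square; paths are unaffected
  because their vertices are distinct.\<close>

locale bounded_degree_graph =
  fixes N :: "'a \<Rightarrow> 'a set" and D :: nat
  assumes finite_N: "finite (N x)" and card_N: "card (N x) \<le> D"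
    and sym_N: "y \<in> N x \<Longrightarrow> x \<in> N y" and D_pos: "D \<ge> 1"
begin

definition simple_path :: "'a list \<Rightarrow> bool" where
  "simple_path p \<longleftrightarrow> distinct p \<and> successively (\<lambda>x y. y \<in> N x) p"

text \<open>The start is left out of the list, so that a path through x is a reversed walk from x,
  then x, then another walk from x.\<close>

primrec walks :: "nat \<Rightarrow> 'a \<Rightarrow> 'a list set" where
  "walks 0 x = {[]}"
| "walks (Suc m) x = (\<Union>y\<in>N x. (#) y ` walks m y)"

lemma finite_walks: "finite (walks m x)"
  by (induction m arbitrary: x) (auto simp: finite_N)

lemma card_walks: "card (walks m x) \<le> D ^ m"
proof (induction m arbitrary: x)
  case (Suc m)
  have "card (walks (Suc m) x) \<le> (\<Sum>y\<in>N x. card ((#) y ` walks m y))"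
    by (simp add: card_UN_le finite_N)
  also have "\<dots> \<le> (\<Sum>y\<in>N x. D ^ m)"
    by (intro sum_mono) (meson Suc card_image_le finite_walks le_trans)
  also have "\<dots> \<le> D ^ Suc m" using card_N by simp
  finally show ?case .
qed simp

lemma mem_walks: "successively (\<lambda>x y. y \<in> N x) (x # p) \<Longrightarrow> p \<in> walks (length p) x"
  by (induction p arbitrary: x) auto

text \<open>The position i of x splits the path into two walks from x with i and n - 1 - i steps.
  There are n positions, and the two walks together leave at most D ^ (n - 1) choices.\<close>

lemma card_paths_through:
  assumes "n \<ge> 1"
  shows "finite {p. simple_path p \<and> length p = n \<and> x \<in> set p}"
    and "card {p. simple_path p \<and> length p = n \<and> x \<in> set p} \<le> n * D ^ (n - 1)"
proof -
  let ?h = "\<lambda>(q, r). rev q @ x # r"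
  let ?U = "\<Union>i<n. ?h ` (walks i x \<times> walks (n - 1 - i) x)"
  have sub: "{p. simple_path p \<and> length p = n \<and> x \<in> set p} \<subseteq> ?U"
  proof safe
    fix p assume p: "simple_path p" "n = length p" "x \<in> set p"
    then obtain q r where pq: "p = q @ x # r" by (meson split_list)
    have "successively (\<lambda>x y. y \<in> N x) (x # r)" "successively (\<lambda>x y. y \<in> N x) (q @ [x])"
      using p pq by (auto simp: simple_path_def successively_append_iff)
    moreover from this(2) have "successively (\<lambda>x y. x \<in> N y) (x # rev q)"
      using successively_rev[of "\<lambda>x y. x \<in> N y" "q @ [x]"] by simp
    then have "successively (\<lambda>x y. y \<in> N x) (x # rev q)"
      by (rule successively_mono) (rule sym_N)
    ultimately have "r \<in> walks (length r) x" "successively (\<lambda>x y. y \<in> N x) (x # rev q)"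
      using mem_walks by blast+
    then have "(rev q, r) \<in> walks (length q) x \<times> walks (length p - 1 - length q) x"
      using mem_walks[of x "rev q"] pq by simp
    moreover have "p = ?h (rev q, r)" using pq by simp
    ultimately show "p \<in> (\<Union>i<length p. ?h ` (walks i x \<times> walks (length p - 1 - i) x))"
      using pq by (intro UN_I[of "length q"] image_eqI[of _ _ "(rev q, r)"]) auto
  qed
  have fin: "finite ?U" by (auto simp: finite_walks)
  show "finite {p. simple_path p \<and> length p = n \<and> x \<in> set p}" using fin sub finite_subset by blast
  have "card {p. simple_path p \<and> length p = n \<and> x \<in> set p} \<le> card ?U" by (rule card_mono[OF fin sub])
  also have "\<dots> \<le> (\<Sum>i<n. card (?h ` (walks i x \<times> walks (n - 1 - i) x)))"
    by (rule card_UN_le) simp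
  also have "\<dots> \<le> (\<Sum>i<n. D ^ (n - 1))"
  proof (rule sum_mono)
    fix i assume i: "i \<in> {..<n}"
    have "card (?h ` (walks i x \<times> walks (n - 1 - i) x)) \<le> card (walks i x) * card (walks (n - 1 - i) x)"
      by (metis card_image_le card_cartesian_product finite_SigmaI finite_walks)
    also have "\<dots> \<le> D ^ i * D ^ (n - 1 - i)" by (intro mult_mono card_walks) auto
    also have "\<dots> = D ^ (n - 1)" using i by (simp flip: power_add)
    finally show "card (?h ` (walks i x \<times> walks (n - 1 - i) x)) \<le> D ^ (n - 1)" .
  qed
  finally show "card {p. simple_path p \<and> length p = n \<and> x \<in> set p} \<le> n * D ^ (n - 1)" by simp
qed

text \<open>Each new vertex is to multiply the number of good colourings by at least 2 D^2. With
  this growth rate the repetitions of half-length n through the new vertex cost at most 2 n D^(2n-1)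
  / (2 D^2)^(n-1) = 4 D n / 2^n colours, and the sum over n is at most 8 D.\<close>

definition num_colors :: nat where
  "num_colors = 2 * D ^ 2 + 8 * D"

text \<open>Extensional functions keep this set finite and let restriction to a subset map one such
  set into another, which is what the counting compares.\<close>

definition good :: "'a set \<Rightarrow> ('a \<Rightarrow> nat) set" where
  "good S = {f \<in> S \<rightarrow>\<^sub>E {..<num_colors}. \<forall>p. set p \<subseteq> S \<and> simple_path p \<longrightarrow> \<not> repetitive f p}"

lemma finite_good: "finite S \<Longrightarrow> finite (good S)"
  by (rule finite_subset[of _ "S \<rightarrow>\<^sub>E {..<num_colors}"]) (auto simp: good_def intro: finite_PiE)

lemma restrict_good:
  assumes "f \<in> good S" "T \<subseteq> S" shows "restrict f T \<in> good T"
proof -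
  have "repetitive (restrict f T) p = repetitive f p" if "set p \<subseteq> T" for p
    using that by (intro repetitive_cong) auto
  then show ?thesis using assms by (auto simp: good_def)
qed

text \<open>Growth by one vertex is iterated. It enters as a hypothesis on proper subsets because
  the lemma is applied inside the very induction that establishes it.\<close>

lemma card_good_mono:
  assumes "finite A" "A \<inter> T = {}"
    and "\<And>B x. B \<subset> T \<union> A \<Longrightarrow> x \<notin> B \<Longrightarrow> 2 * D ^ 2 * card (good B) \<le> card (good (insert x B))"
  shows "(2 * D ^ 2) ^ card A * card (good T) \<le> card (good (T \<union> A))"
  using assms
proof (induction A rule: finite_induct)
  case (insert x A)
  have "(2 * D ^ 2) ^ card (insert x A) * card (good T) = 2 * D ^ 2 * ((2 * D ^ 2) ^ card A * card (good T))"
    using insert.hyps by simp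
  also have "\<dots> \<le> 2 * D ^ 2 * card (good (T \<union> A))"
    using insert.prems by (intro mult_left_mono insert.IH) auto
  also have "\<dots> \<le> card (good (insert x (T \<union> A)))"
    by (intro insert.prems(2)) (use insert in auto)
  finally show ?case by simp
qed simp

text \<open>
  Rosenfeld's counting argument.  A repetitive path through x is coloured on the half containing x by
  a copy of the other half, so the bad extensions it causes are counted by the good colourings of the
  complement of that half, of which the induction hypothesis says that there are few.
\<close>

lemma card_good_insert:
  assumes "finite S" "x \<notin> S"
  shows "2 * D ^ 2 * card (good S) \<le> card (good (insert x S))"
  using assms
proof (induction "card S" arbitrary: S x rule: less_induct)
  case less
  let ?g = "real (card (good S))"
  \<comment> \<open>All ways to give x a colour on top of a good colouring of S; any repetition that
    arises must pass through x.\<close>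
  define Ext where "Ext = (\<lambda>(y, g). g(x := y)) ` ({..<num_colors} \<times> good S)"
  define Q where "Q n = {p. simple_path p \<and> length p = 2 * n \<and> x \<in> set p \<and> set p \<subseteq> insert x S}" for n
  define B where "B p = {f \<in> Ext. repetitive f p}" for p
  let ?Bad = "\<Union>n\<in>{1..Suc (card S)}. \<Union>p\<in>Q n. B p"
  have "inj_on (\<lambda>(y, g). g(x := y)) ({..<num_colors} \<times> (S \<rightarrow>\<^sub>E {..<num_colors}))"
    using inj_combinator[OF less.prems(2), of "\<lambda>_. {..<num_colors}"] by simp
  then have "inj_on (\<lambda>(y, g). g(x := y)) ({..<num_colors} \<times> good S)"
    by (rule inj_on_subset) (auto simp: good_def)
  then have card_Ext: "card Ext = num_colors * card (good S)"
    unfolding Ext_def by (simp add: card_image card_cartesian_product)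
  have fin_Ext: "finite Ext" unfolding Ext_def using less.prems finite_good by auto
  have Ext_restrict: "restrict f S \<in> good S" if "f \<in> Ext" for f
  proof -
    obtain y g where f: "f = g(x := y)" "g \<in> good S" using \<open>f \<in> Ext\<close> unfolding Ext_def by auto
    have "restrict f S = restrict g S"
      unfolding f by (rule restrict_ext) (use less.prems in auto)
    then show ?thesis using restrict_good[OF f(2), of S] by simp
  qed
  have Ext_PiE: "Ext \<subseteq> insert x S \<rightarrow>\<^sub>E {..<num_colors}"
    unfolding Ext_def good_def by (auto simp: PiE_iff extensional_def split: if_splits)
  have fin_Q: "finite (Q n)" and card_Q: "card (Q n) \<le> 2 * n * D ^ (2 * n - 1)" if "n \<ge> 1" for n
  proof -
    have "Q n \<subseteq> {p. simple_path p \<and> length p = 2 * n \<and> x \<in> set p}" unfolding Q_def by auto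
    then show "finite (Q n)" "card (Q n) \<le> 2 * n * D ^ (2 * n - 1)"
      using card_paths_through[of "2 * n" x] that
      by (auto intro: finite_subset order_trans[OF card_mono])
  qed
  have sub: "Ext - good (insert x S) \<subseteq> ?Bad"
  proof
    fix f assume f: "f \<in> Ext - good (insert x S)"
    then obtain p where p: "set p \<subseteq> insert x S" "simple_path p" "repetitive f p"
      using Ext_PiE unfolding good_def by auto
    have "x \<in> set p"
    proof (rule ccontr)
      assume "x \<notin> set p"
      then have "set p \<subseteq> S" using p by auto
      moreover from this have "repetitive (restrict f S) p"
        using p(3) repetitive_cong[of p "restrict f S" f] by (simp add: subset_iff)
      ultimately show False using Ext_restrict f p unfolding good_def by auto
    qed
    obtain xs where xs: "xs \<noteq> []" "map f p = xs @ xs" using p(3) unfolding repetitive_def by auto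
    then have "length (map f p) = length (xs @ xs)" by simp
    then have len: "length p = 2 * length xs" by simp
    have "length p = card (set p)" using p(2) by (simp add: simple_path_def distinct_card)
    also have "\<dots> \<le> Suc (card S)" using p(1) less.prems
      by (metis card_insert_disjoint card_mono finite_insert)
    finally have "length xs \<in> {1..Suc (card S)}" using xs len by (cases xs) auto
    moreover have "p \<in> Q (length xs)" using p len \<open>x \<in> set p\<close> unfolding Q_def by auto
    moreover have "f \<in> B p" using f p unfolding B_def by auto
    ultimately show "f \<in> ?Bad" by blast
  qed
  \<comment> \<open>The exponent is n - 1 because the half through x has n vertices, but x itself is
    not in S.\<close>
  have card_B: "card (B p) * (2 * D ^ 2) ^ (n - 1) \<le> card (good S)" if n: "n \<ge> 1" and p: "p \<in> Q n" for n p
  proof (cases "B p = {}")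
    case False
    then obtain f0 where "f0 \<in> B p" by auto
    then have "repetitive f0 p" by (simp add: B_def)
    then obtain xs ys where xy: "p = xs @ ys" "length xs = length ys" "xs \<noteq> []"
      by (elim repetitive_append)
    have len: "length xs = n" "length ys = n" using p xy unfolding Q_def by auto
    have dis: "distinct p" "set xs \<inter> set ys = {}" using p xy unfolding Q_def simple_path_def by auto
    have eq: "map f xs = map f ys" if f: "f \<in> B p" for f
    proof -
      obtain as bs where ab: "p = as @ bs" "length as = length bs" "map f as = map f bs"
        using f unfolding B_def by (auto elim: repetitive_append)
      have "length as = length xs" using arg_cong[OF ab(1), of length] ab(2) xy by simp
      then have "as = xs \<and> bs = ys" using ab(1) xy(1) by (simp add: append_eq_append_conv)
      then show ?thesis using ab(3) by simp
    qed
    \<comment> \<open>Here \<open>h\<close> is the half through x and \<open>h'\<close> the other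
      one; from now on their order along the path is irrelevant.\<close>
    obtain h h' where h: "x \<in> set h" "length h = n" "length h' = n" "set h \<inter> set h' = {}" "distinct h"
        "set h \<subseteq> insert x S" "set h' \<subseteq> insert x S" "\<And>f. f \<in> B p \<Longrightarrow> map f h = map f h'"
    proof (cases "x \<in> set xs")
      case True
      then show ?thesis using that[of xs ys] len dis eq xy(1,2) p unfolding Q_def by simp
    next
      case False
      then show ?thesis using that[of ys xs] len dis eq[symmetric] xy(1,2) p unfolding Q_def by (simp add: Int_commute)
    qed
    let ?T = "insert x S - set h"
    have T: "?T \<subseteq> S" using h(1) by auto
    \<comment> \<open>The colours on \<open>h\<close> can be forgotten: they are copied from
      \<open>h'\<close>, which is disjoint from \<open>h\<close> and so survives in
      \<open>?T\<close>.\<close>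
    have inj: "inj_on (\<lambda>f. restrict f ?T) (B p)"
    proof (rule inj_onI)
      fix f g assume f: "f \<in> B p" and g: "g \<in> B p" and fg: "restrict f ?T = restrict g ?T"
      have T_eq: "f y = g y" if "y \<in> ?T" for y using fun_cong[OF fg, of y] that by simp
      have "set h' \<subseteq> ?T" using h(4,7) by blast
      then have "map f h' = map g h'" by (intro map_cong refl T_eq) blast
      then have h_eq: "map f h = map g h" by (simp only: h(8)[OF f] h(8)[OF g])
      have "f y = g y" if "y \<in> insert x S" for y
        using that T_eq[of y] h_eq by (cases "y \<in> set h") (auto simp only: map_eq_conv)
      moreover have "f \<in> extensional (insert x S)" "g \<in> extensional (insert x S)"
        using f g Ext_PiE unfolding B_def by (auto simp: PiE_iff)
      ultimately show "f = g" by (meson extensionalityI)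
    qed
    have "(\<lambda>f. restrict f ?T) ` B p \<subseteq> good ?T"
    proof
      fix g assume "g \<in> (\<lambda>f. restrict f ?T) ` B p"
      then obtain f where f: "f \<in> Ext" "g = restrict f ?T" unfolding B_def by auto
      have "restrict (restrict f S) ?T = g" using T f(2) by (simp add: Int_absorb1)
      then show "g \<in> good ?T" using restrict_good[OF Ext_restrict[OF f(1)] T] by (simp only:)
    qed
    then have BT: "card (B p) \<le> card (good ?T)"
      by (rule card_inj_on_le[OF inj]) (simp add: finite_good less.prems(1))
    have "(2 * D ^ 2) ^ card (S - ?T) * card (good ?T) \<le> card (good (?T \<union> (S - ?T)))"
    proof (rule card_good_mono)
      fix C y assume C: "C \<subset> ?T \<union> (S - ?T)" "y \<notin> C"
      then have "C \<subset> S" using T by auto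
      then show "2 * D ^ 2 * card (good C) \<le> card (good (insert y C))"
        by (intro less.hyps[OF psubset_card_mono[OF less.prems(1)]] C(2) finite_subset[OF _ less.prems(1)]) auto
    qed (use less.prems in auto)
    moreover have "?T \<union> (S - ?T) = S" using T by auto
    moreover have "S - ?T = set h - {x}" using h(6) less.prems(2) by auto
    moreover have "card (set h - {x}) = n - 1" using h(1,2,5) by (simp add: distinct_card)
    ultimately have "(2 * D ^ 2) ^ (n - 1) * card (good ?T) \<le> card (good S)" by (simp only:)
    moreover have "card (B p) * (2 * D ^ 2) ^ (n - 1) \<le> (2 * D ^ 2) ^ (n - 1) * card (good ?T)"
      using BT by simp
    ultimately show ?thesis by (rule order_trans[rotated])
  qed simp
  have "real (card ?Bad) \<le> (\<Sum>n\<in>{1..Suc (card S)}. real (card (\<Union>p\<in>Q n. B p)))"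
    using card_UN_le[of "{1..Suc (card S)}" "\<lambda>n. \<Union>p\<in>Q n. B p"] by (simp flip: of_nat_sum)
  also have "\<dots> \<le> (\<Sum>n\<in>{1..Suc (card S)}. 4 * D * ?g * (real n / 2 ^ n))"
  proof (rule sum_mono)
    fix n assume "n \<in> {1..Suc (card S)}"
    then have n: "n \<ge> 1" by simp
    then obtain m where m: "n = Suc m" by (cases n) auto
    have D0: "real D > 0" using D_pos by simp
    have "real (card (\<Union>p\<in>Q n. B p)) \<le> (\<Sum>p\<in>Q n. real (card (B p)))"
      using card_UN_le[OF fin_Q[OF n], of B] by (simp flip: of_nat_sum)
    also have "\<dots> \<le> (\<Sum>p\<in>Q n. ?g / (2 * real D ^ 2) ^ m)"
    proof (rule sum_mono)
      fix p assume "p \<in> Q n"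
      then have "real (card (B p) * (2 * D ^ 2) ^ m) \<le> ?g"
        using card_B[OF n, of p] m by (simp only: of_nat_le_iff) simp
      then show "real (card (B p)) \<le> ?g / (2 * real D ^ 2) ^ m"
        using D0 by (simp add: pos_le_divide_eq)
    qed
    also have "\<dots> = real (card (Q n)) * (?g / (2 * real D ^ 2) ^ m)" by simp
    also have "\<dots> \<le> real (2 * n * D ^ (2 * n - 1)) * (?g / (2 * real D ^ 2) ^ m)"
      using card_Q[OF n] by (intro mult_right_mono) (simp_all only: of_nat_le_iff, simp)
    \<comment> \<open>The growth rate 2 D^2 is chosen for this cancellation: all powers of D but one
      disappear, and a convergent series remains.\<close>
    also have "\<dots> = 4 * D * ?g * (real n / 2 ^ n)"
    proof -
      have "2 * n - 1 = Suc (2 * m)" using m by simp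
      moreover have "(real D ^ 2) ^ m = real D ^ (2 * m)" by (simp add: power_mult)
      ultimately show ?thesis using D0 m by (simp add: power_mult_distrib field_simps)
    qed
    finally show "real (card (\<Union>p\<in>Q n. B p)) \<le> 4 * D * ?g * (real n / 2 ^ n)" .
  qed
  also have "\<dots> = 4 * D * ?g * (\<Sum>n\<in>{1..Suc (card S)}. real n / 2 ^ n)"
    by (rule sum_distrib_left[symmetric])
  also have "\<dots> \<le> 4 * D * ?g * 2"
  proof (rule mult_left_mono)
    have "(\<Sum>n\<in>{1..Suc (card S)}. real n / 2 ^ n) \<le> (\<Sum>n\<le>Suc (card S). real n / 2 ^ n)"
      by (rule sum_mono2) auto
    then show "(\<Sum>n\<in>{1..Suc (card S)}. real n / 2 ^ n) \<le> 2"
      unfolding sum_nat_div_power2 by (rule order_trans) simp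
  qed simp
  finally have bad: "real (card ?Bad) \<le> 8 * D * ?g" by simp
  have "finite ?Bad"
    by (rule finite_subset[OF _ fin_Ext]) (auto simp: B_def)
  then have "card (Ext - good (insert x S)) \<le> card ?Bad" by (rule card_mono[OF _ sub])
  moreover have "card Ext \<le> card (Ext - good (insert x S)) + card (good (insert x S))"
  proof -
    have "card Ext \<le> card ((Ext - good (insert x S)) \<union> good (insert x S))"
      by (rule card_mono) (auto simp: fin_Ext finite_good less.prems(1))
    then show ?thesis using card_Un_le le_trans by blast
  qed
  ultimately have "real (num_colors * card (good S)) \<le> 8 * D * ?g + real (card (good (insert x S)))"
    using bad card_Ext by linarith
  then have "real (2 * D ^ 2 * card (good S)) \<le> real (card (good (insert x S)))"
    by (simp add: num_colors_def algebra_simps)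
  then show ?case by (simp only: of_nat_le_iff)
qed

lemma good_nonempty: "finite S \<Longrightarrow> good S \<noteq> {}"
proof (induction S rule: finite_induct)
  case empty
  have "(\<lambda>_. undefined) \<in> good {}" by (auto simp: good_def repetitive_def)
  then show ?case by blast
next
  case (insert x S)
  have "card (good S) > 0" using insert finite_good by (simp add: card_gt_0_iff)
  then have "card (good (insert x S)) > 0"
    using card_good_insert[OF insert.hyps] D_pos
    by (metis One_nat_def less_le_trans nat_0_less_mult_iff not_gr_zero pos2 power_not_zero Suc_n_not_le_n)
  then show ?case using card_gt_0_iff by blast
qed

text \<open>A compactness argument: the condition imposed by one path depends on finitely many
  vertices and is therefore closed, and finitely many conditions are met by a good colouring of the
  finite set of vertices they involve.\<close>

theorem nonrepetitive_coloring:
  "\<exists>f. range f \<subseteq> {..<num_colors} \<and> (\<forall>p. simple_path p \<longrightarrow> \<not> repetitive f p)"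
proof -
  let ?X = "product_topology (\<lambda>_::'a. discrete_topology {..<num_colors}) UNIV"
  define K where "K p = {f \<in> UNIV \<rightarrow>\<^sub>E {..<num_colors}. \<not> repetitive f p}" for p :: "'a list"
  have "compact_space ?X" by (simp add: compact_space_product_topology compact_space_discrete_topology)
  moreover have closed: "closedin ?X (K p)" for p
  proof -
    have "openin ?X {f \<in> UNIV \<rightarrow>\<^sub>E {..<num_colors}. repetitive f p}"
      by (rule openin_product_discrete[of "set p"]) (auto cong: repetitive_cong)
    moreover have "K p = topspace ?X - {f \<in> UNIV \<rightarrow>\<^sub>E {..<num_colors}. repetitive f p}"
      by (auto simp: K_def)
    ultimately show ?thesis by (metis closedin_topspace openin_closedin_eq closedin_diff)
  qed
  moreover have "\<Inter> F \<noteq> {}" if F: "finite F" "F \<subseteq> K ` Collect simple_path" for F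
  proof -
    obtain P where P: "finite P" "P \<subseteq> Collect simple_path" "F = K ` P"
      using F by (meson finite_subset_image)
    define S where "S = (\<Union>p\<in>P. set p)"
    have "finite S" using P by (simp add: S_def)
    then obtain g where g: "g \<in> good S" using good_nonempty by blast
    \<comment> \<open>The default 0 is a legal colour because \<open>num_colors\<close> is
      positive.\<close>
    define f where "f y = (if y \<in> S then g y else 0)" for y
    have "f \<in> K p" if "p \<in> P" for p
    proof -
      have "set p \<subseteq> S" using that by (auto simp: S_def)
      moreover from this have "repetitive f p = repetitive g p"
        by (intro repetitive_cong) (auto simp: f_def)
      moreover have "num_colors > 0" using D_pos by (simp add: num_colors_def)
      ultimately show ?thesis using g P that by (auto simp: K_def good_def f_def PiE_iff)
    qed
    then show ?thesis using P by blast
  qed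
  ultimately have "\<Inter> (K ` Collect simple_path) \<noteq> {}"
    unfolding compact_space_fip by blast
  then obtain f where f: "\<And>p. simple_path p \<Longrightarrow> f \<in> K p" by blast
  \<comment> \<open>The empty path is a convenient member of the family: being in its
    \<open>K\<close> already bounds the colours of f.\<close>
  have "simple_path []" by (simp add: simple_path_def)
  then have "f \<in> UNIV \<rightarrow>\<^sub>E {..<num_colors}" using f unfolding K_def by blast
  then show ?thesis using f by (intro exI[of _ f]) (auto simp: K_def)
qed

end

section \<open>Schreier graphs and stabilizers\<close>

interpretation Gamma: group "Gamma_group k" for k
  by (rule group_Gamma_group)

lemma carrier_Gamma: "w \<in> carrier (Gamma_group k) \<longleftrightarrow> set w \<subseteq> {..<k} \<and> distinct_adj w"
  by (simp add: Gamma_group_def)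

lemma mult_Gamma: "u \<otimes>\<^bsub>Gamma_group k\<^esub> v = foldr lmul u v"
  by (simp add: Gamma_group_def)

lemma one_Gamma: "\<one>\<^bsub>Gamma_group k\<^esub> = []"
  by (simp add: Gamma_group_def)

lemma inv_Gamma:
  assumes "w \<in> carrier (Gamma_group k)" shows "inv\<^bsub>Gamma_group k\<^esub> w = rev w"
proof (rule Gamma.inv_equality)
  show "rev w \<otimes>\<^bsub>Gamma_group k\<^esub> w = \<one>\<^bsub>Gamma_group k\<^esub>"
    using foldr_lmul_rev[of "[]" w] foldr_lmul_Nil[of w] assms
    by (simp add: mult_Gamma one_Gamma carrier_Gamma)
qed (use assms in \<open>auto simp: carrier_Gamma\<close>)

lemma mult_Gamma_append: "distinct_adj (u @ v) \<Longrightarrow> u \<otimes>\<^bsub>Gamma_group k\<^esub> v = u @ v"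
proof (induction u)
  case (Cons a u)
  then have "distinct_adj (u @ v)" by (auto simp: distinct_adj_Cons)
  then show ?case using Cons by (cases "u @ v") (auto simp: mult_Gamma lmul_def)
qed (simp add: mult_Gamma)

lemma length_lmul: "length (lmul a w) \<le> Suc (length w)"
  by (auto simp: lmul_def split: list.splits)

lemma length_mult_Gamma: "length (u \<otimes>\<^bsub>Gamma_group k\<^esub> v) \<le> length u + length v"
  unfolding mult_Gamma
  by (induction u) (auto intro: order_trans[OF length_lmul])

lemma (in group) inv_mult_cancel:
  assumes "x \<in> carrier G" "y \<in> carrier G"
  shows "inv x \<otimes> (x \<otimes> y) = y" "x \<otimes> (inv x \<otimes> y) = y"
  using assms by (simp_all flip: m_assoc)

lemma (in group) mem_conj_act:
  assumes "H \<subseteq> carrier G" "g \<in> carrier G"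
  shows "x \<in> conj_act G g H \<longleftrightarrow> x \<in> carrier G \<and> inv g \<otimes> x \<otimes> g \<in> H"
proof
  assume "x \<in> conj_act G g H"
  then obtain h where h: "h \<in> H" "x = g \<otimes> h \<otimes> inv g"
    by (auto simp: conj_act_def l_coset_def r_coset_def)
  moreover have "h \<in> carrier G" using h(1) assms(1) by blast
  ultimately show "x \<in> carrier G \<and> inv g \<otimes> x \<otimes> g \<in> H"
    using assms(2) by (simp add: m_assoc inv_mult_cancel)
next
  assume x: "x \<in> carrier G \<and> inv g \<otimes> x \<otimes> g \<in> H"
  then have "x = g \<otimes> (inv g \<otimes> x \<otimes> g) \<otimes> inv g"
    using assms by (simp add: m_assoc inv_mult_cancel)
  then show "x \<in> conj_act G g H" using x unfolding conj_act_def l_coset_def r_coset_def by blast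
qed

lemma (in group) subgroup_conj_act:
  assumes "subgroup H G" "g \<in> carrier G" shows "subgroup (conj_act G g H) G"
proof -
  interpret H: subgroup H G by fact
  have mem: "x \<in> conj_act G g H \<longleftrightarrow> x \<in> carrier G \<and> inv g \<otimes> x \<otimes> g \<in> H" for x
    using mem_conj_act assms(2) H.subset by blast
  show ?thesis
  proof (rule subgroupI)
    show "conj_act G g H \<subseteq> carrier G" using mem by blast
    have "\<one> \<in> conj_act G g H" using assms by (simp add: mem)
    then show "conj_act G g H \<noteq> {}" by blast
    fix x assume x: "x \<in> conj_act G g H"
    then have "inv g \<otimes> inv x \<otimes> g = inv (inv g \<otimes> x \<otimes> g)"
      using assms(2) by (simp add: mem inv_mult_group m_assoc)
    then show "inv x \<in> conj_act G g H" using x assms(2) by (simp add: mem)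
    fix y assume y: "y \<in> conj_act G g H"
    then have "inv g \<otimes> (x \<otimes> y) \<otimes> g = (inv g \<otimes> x \<otimes> g) \<otimes> (inv g \<otimes> y \<otimes> g)"
      using assms(2) x by (simp add: mem m_assoc inv_mult_cancel)
    then show "x \<otimes> y \<in> conj_act G g H" using x y by (simp add: mem)
  qed
qed

text \<open>The inverse of \<open>schreier_graph\<close> up to isomorphism, defined for every vertex
  type, so that coset graphs and coloured graphs become comparable as subgroups.\<close>

definition stab :: "nat \<Rightarrow> 'v rlgraph \<Rightarrow> nat list set" where
  "stab k R = {w \<in> carrier (Gamma_group k). foldr (neighbour R) w (rl_root R) = rl_root R}"

text \<open>An intrinsic description of the graphs isomorphic to some \<open>schreier_graph\<close>.
  It covers the coset graphs, the other members of their classes and the coloured graph on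
  V.\<close>

locale schreier =
  fixes k :: nat and R :: "'v rlgraph"
  assumes root: "rl_root R \<in> rl_verts R"
    and edge_verts: "(x, i, y) \<in> rl_edges R \<Longrightarrow> x \<in> rl_verts R"
    and edge_label: "(x, i, y) \<in> rl_edges R \<Longrightarrow> i < k"
    and edge_sym: "(x, i, y) \<in> rl_edges R \<Longrightarrow> (y, i, x) \<in> rl_edges R"
    and edge_ex1: "x \<in> rl_verts R \<Longrightarrow> i < k \<Longrightarrow> \<exists>!y. (x, i, y) \<in> rl_edges R"
    and reachable: "x \<in> rl_verts R \<Longrightarrow> \<exists>w. set w \<subseteq> {..<k} \<and> x = foldr (neighbour R) w (rl_root R)"
begin

abbreviation walk :: "nat list \<Rightarrow> 'v" where
  "walk w \<equiv> foldr (neighbour R) w (rl_root R)"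

lemma wf: "wf_rlgraph R"
  using root edge_verts edge_verts[OF edge_sym] by (auto simp: wf_rlgraph_def)

lemma edge_iff:
  assumes "x \<in> rl_verts R" "i < k"
  shows "(x, i, y) \<in> rl_edges R \<longleftrightarrow> y = neighbour R i x"
  using theI'[OF edge_ex1[OF assms]] edge_ex1[OF assms] unfolding neighbour_def by blast

lemma neighbour_verts: "x \<in> rl_verts R \<Longrightarrow> i < k \<Longrightarrow> neighbour R i x \<in> rl_verts R"
  using edge_verts[OF edge_sym] edge_iff by blast

lemma neighbour_neighbour: "x \<in> rl_verts R \<Longrightarrow> i < k \<Longrightarrow> neighbour R i (neighbour R i x) = x"
  using edge_sym[of x i "neighbour R i x"] edge_iff neighbour_verts by simp

lemma walk_verts: "x \<in> rl_verts R \<Longrightarrow> set w \<subseteq> {..<k} \<Longrightarrow> foldr (neighbour R) w x \<in> rl_verts R"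
  by (induction w) (auto simp: neighbour_verts)

lemma walk_lmul:
  assumes "x \<in> rl_verts R" "a < k" "set w \<subseteq> {..<k}"
  shows "foldr (neighbour R) (lmul a w) x = neighbour R a (foldr (neighbour R) w x)"
  using assms by (auto simp: lmul_def neighbour_neighbour walk_verts split: list.splits)

text \<open>Cancelling two equal letters does not change where a walk ends, because every label acts
  as an involution.\<close>

lemma walk_mult:
  assumes "x \<in> rl_verts R" "set u \<subseteq> {..<k}" "set v \<subseteq> {..<k}"
  shows "foldr (neighbour R) (foldr lmul u v) x = foldr (neighbour R) u (foldr (neighbour R) v x)"
  using assms
proof (induction u)
  case (Cons a u)
  then have "set (foldr lmul u v) \<subseteq> {..<k}" using set_foldr_lmul[of u v] by auto
  then show ?case using Cons by (simp add: walk_lmul)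
qed simp

lemma walk_rev:
  assumes "x \<in> rl_verts R" "set w \<subseteq> {..<k}"
  shows "foldr (neighbour R) (rev w) (foldr (neighbour R) w x) = x"
  using assms by (induction w) (auto simp: neighbour_neighbour walk_verts)

lemma walk_eq_iff:
  assumes "x \<in> rl_verts R" "y \<in> rl_verts R" "set w \<subseteq> {..<k}"
  shows "foldr (neighbour R) w x = y \<longleftrightarrow> x = foldr (neighbour R) (rev w) y"
  using walk_rev[of x w] walk_rev[of y "rev w"] assms by auto

text \<open>The vertices are the left cosets of the stabilizer of the root; later, questions whether
  two path vertices coincide are settled in the group through this.\<close>

lemma mem_stab:
  assumes "u \<in> carrier (Gamma_group k)" "v \<in> carrier (Gamma_group k)"
  shows "inv\<^bsub>Gamma_group k\<^esub> u \<otimes>\<^bsub>Gamma_group k\<^esub> v \<in> stab k R \<longleftrightarrow> walk u = walk v"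
proof -
  have "walk (rev u \<otimes>\<^bsub>Gamma_group k\<^esub> v) = foldr (neighbour R) (rev u) (walk v)"
    using assms by (simp add: mult_Gamma carrier_Gamma walk_mult root)
  moreover have "rl_root R = foldr (neighbour R) (rev u) (walk v) \<longleftrightarrow> walk u = walk v"
    using assms by (intro walk_eq_iff[symmetric]) (auto simp: carrier_Gamma root walk_verts)
  ultimately show ?thesis using assms Gamma.m_closed[OF Gamma.inv_closed] by (auto simp: stab_def inv_Gamma)
qed

lemma stab_subset: "stab k R \<subseteq> carrier (Gamma_group k)"
  by (auto simp: stab_def)

lemma subgroup_stab: "subgroup (stab k R) (Gamma_group k)"
proof (rule Gamma.subgroupI)
  have "[] \<in> stab k R" by (simp add: stab_def carrier_Gamma)
  then show "stab k R \<noteq> {}" by blast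
  fix u assume u: "u \<in> stab k R"
  then have uc: "u \<in> carrier (Gamma_group k)" "walk u = walk []" by (simp_all add: stab_def)
  then have "inv\<^bsub>Gamma_group k\<^esub> u \<otimes>\<^bsub>Gamma_group k\<^esub> \<one>\<^bsub>Gamma_group k\<^esub> \<in> stab k R"
    using mem_stab[of u "\<one>\<^bsub>Gamma_group k\<^esub>"] by (simp only: one_Gamma Gamma.one_closed[unfolded one_Gamma])
  then show "inv\<^bsub>Gamma_group k\<^esub> u \<in> stab k R"
    by (simp only: Gamma.r_one[OF Gamma.inv_closed[OF uc(1)]])
  fix v assume v: "v \<in> stab k R"
  then show "u \<otimes>\<^bsub>Gamma_group k\<^esub> v \<in> stab k R"
    using u Gamma.m_closed[of u k v] by (auto simp: stab_def mult_Gamma carrier_Gamma walk_mult root)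
qed (rule stab_subset)

lemma verts_eq: "rl_verts R = walk ` {w. set w \<subseteq> {..<k}}"
proof (intro equalityI subsetI)
  fix x assume "x \<in> rl_verts R"
  then show "x \<in> walk ` {w. set w \<subseteq> {..<k}}" using reachable[of x] by blast
qed (auto simp: walk_verts root)

lemma reach_eq: "reach R r = walk ` {w. set w \<subseteq> {..<k} \<and> length w \<le> r}"
proof (induction r)
  case (Suc r)
  show ?case
  proof (intro equalityI subsetI)
    fix y assume "y \<in> reach R (Suc r)"
    then consider "y \<in> reach R r" | x i where "x \<in> reach R r" "(x, i, y) \<in> rl_edges R" by auto
    then show "y \<in> walk ` {w. set w \<subseteq> {..<k} \<and> length w \<le> Suc r}"
    proof cases
      case 1
      then show ?thesis using Suc by auto
    next
      case 2
      then obtain w where w: "set w \<subseteq> {..<k}" "length w \<le> r" "x = walk w" using Suc by auto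
      moreover have i: "i < k" using 2(2) by (rule edge_label)
      moreover have "y = neighbour R i x" using 2(2) edge_iff[OF edge_verts[OF 2(2)] i] by blast
      ultimately show ?thesis by (intro image_eqI[of _ _ "i # w"]) auto
    qed
  next
    fix y assume "y \<in> walk ` {w. set w \<subseteq> {..<k} \<and> length w \<le> Suc r}"
    then obtain w where w: "set w \<subseteq> {..<k}" "length w \<le> Suc r" "y = walk w" by auto
    show "y \<in> reach R (Suc r)"
    proof (cases w)
      case Nil
      then show ?thesis using w Suc by (auto intro: image_eqI[of _ _ "[]"])
    next
      case (Cons i v)
      then have "walk v \<in> reach R r" using w Suc by auto
      moreover have "(walk v, i, y) \<in> rl_edges R" using w Cons edge_iff walk_verts root by simp
      ultimately show ?thesis by auto
    qed
  qed
qed auto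

end

section \<open>Rooted isomorphisms of graphs and balls in terms of stabilizers\<close>

lemma rl_iso_sym:
  assumes "rl_iso R R'" "rl_root R \<in> rl_verts R" shows "rl_iso R' R"
proof -
  obtain f where f: "bij_betw f (rl_verts R) (rl_verts R')" "f (rl_root R) = rl_root R'"
      and e: "\<And>x y i. x \<in> rl_verts R \<Longrightarrow> y \<in> rl_verts R \<Longrightarrow> (x, i, y) \<in> rl_edges R \<longleftrightarrow> (f x, i, f y) \<in> rl_edges R'"
    using assms(1) unfolding rl_iso_def by blast
  let ?g = "inv_into (rl_verts R) f"
  have g: "bij_betw ?g (rl_verts R') (rl_verts R)" using f(1) by (rule bij_betw_inv_into)
  moreover have "?g (rl_root R') = rl_root R" using bij_betw_inv_into_left[OF f(1) assms(2)] f(2) by simp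
  moreover have "(x, i, y) \<in> rl_edges R' \<longleftrightarrow> (?g x, i, ?g y) \<in> rl_edges R"
    if "x \<in> rl_verts R'" "y \<in> rl_verts R'" for x y i
    using e[of "?g x" "?g y" i] that bij_betw_apply[OF g] bij_betw_inv_into_right[OF f(1)] by simp
  ultimately show ?thesis unfolding rl_iso_def by blast
qed

lemma rl_iso_trans:
  assumes "rl_iso R R'" "rl_iso R' R''" shows "rl_iso R R''"
proof -
  obtain f where f: "bij_betw f (rl_verts R) (rl_verts R')" "f (rl_root R) = rl_root R'"
      and e: "\<And>x y i. x \<in> rl_verts R \<Longrightarrow> y \<in> rl_verts R \<Longrightarrow> (x, i, y) \<in> rl_edges R \<longleftrightarrow> (f x, i, f y) \<in> rl_edges R'"
    using assms(1) unfolding rl_iso_def by blast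
  obtain g where g: "bij_betw g (rl_verts R') (rl_verts R'')" "g (rl_root R') = rl_root R''"
      and e': "\<And>x y i. x \<in> rl_verts R' \<Longrightarrow> y \<in> rl_verts R' \<Longrightarrow> (x, i, y) \<in> rl_edges R' \<longleftrightarrow> (g x, i, g y) \<in> rl_edges R''"
    using assms(2) unfolding rl_iso_def by blast
  show ?thesis unfolding rl_iso_def
    by (rule exI[of _ "g \<circ> f"])
      (use f g e e' bij_betw_apply[OF f(1)] in \<open>auto intro: bij_betw_trans\<close>)
qed

lemma bij_betw_factor:
  assumes "\<And>u v. u \<in> W \<Longrightarrow> v \<in> W \<Longrightarrow> p u = p v \<longleftrightarrow> q u = q v"
  obtains f where "bij_betw f (p ` W) (q ` W)" "\<And>u. u \<in> W \<Longrightarrow> f (p u) = q u"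
proof
  let ?f = "q \<circ> inv_into W p"
  show f: "?f (p u) = q u" if "u \<in> W" for u
    using assms[OF inv_into_into[of "p u" p W] that] f_inv_into_f[of "p u" p W] that by simp
  show "bij_betw ?f (p ` W) (q ` W)"
    unfolding bij_betw_def inj_on_def using assms f by (auto simp: image_image simp del: o_apply)
qed

text \<open>For subgroups this is equality of their traces on the ball of radius n in the word
  metric; a list that is not a reduced word over the generators belongs to neither.\<close>

definition agree :: "nat \<Rightarrow> nat list set \<Rightarrow> nat list set \<Rightarrow> bool" where
  "agree n H H' \<longleftrightarrow> (\<forall>w. length w \<le> n \<longrightarrow> (w \<in> H \<longleftrightarrow> w \<in> H'))"

lemma agree_refl: "agree n H H"
  and agree_trans: "agree n H H' \<Longrightarrow> agree n H' H'' \<Longrightarrow> agree n H H''"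
  and agree_mono: "agree n H H' \<Longrightarrow> m \<le> n \<Longrightarrow> agree m H H'"
  by (auto simp: agree_def)

locale schreier_pair = R: schreier k R + R': schreier k R'
  for k :: nat and R :: "'v rlgraph" and R' :: "'w rlgraph"
begin

text \<open>The factor 2: walks u and v meet exactly when \<open>rev u @ v\<close> closes up at the
  root, and conversely a word of length at most 2r is cut after r letters into such a pair.\<close>

lemma agree_iff_walks:
  "agree (2 * r) (stab k R) (stab k R') \<longleftrightarrow>
    (\<forall>u v. set u \<subseteq> {..<k} \<longrightarrow> set v \<subseteq> {..<k} \<longrightarrow> length u \<le> r \<longrightarrow> length v \<le> r \<longrightarrow>
       (R.walk u = R.walk v \<longleftrightarrow> R'.walk u = R'.walk v))" (is "?A \<longleftrightarrow> ?B")
proof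
  assume A: ?A
  show ?B
  proof (intro allI impI)
    fix u v assume uv: "set u \<subseteq> {..<k}" "set v \<subseteq> {..<k}" "length u \<le> r" "length v \<le> r"
    \<comment> \<open>The words u and v need not be reduced, so the closed walk is reduced first;
      this cannot make it longer.\<close>
    let ?w = "foldr lmul (rev u @ v) []"
    have w: "?w \<in> carrier (Gamma_group k)"
      using foldr_lmul_closed[of "[]" "rev u @ v"] set_foldr_lmul[of "rev u @ v" "[]"] uv
      by (auto simp: carrier_Gamma)
    have "length ?w \<le> 2 * r"
      using length_mult_Gamma[of k "rev u @ v" "[]"] uv by (simp add: mult_Gamma)
    moreover have "?w \<in> stab k R \<longleftrightarrow> R.walk u = R.walk v"
      using w uv R.walk_eq_iff[of "rl_root R" "R.walk v" u] R.root R.walk_verts[of _ v] R.walk_mult[of _ "rev u @ v" "[]"]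
      by (auto simp: stab_def simp del: foldr_append) (auto simp: foldr_append)
    moreover have "?w \<in> stab k R' \<longleftrightarrow> R'.walk u = R'.walk v"
      using w uv R'.walk_eq_iff[of "rl_root R'" "R'.walk v" u] R'.root R'.walk_verts[of _ v] R'.walk_mult[of _ "rev u @ v" "[]"]
      by (auto simp: stab_def simp del: foldr_append) (auto simp: foldr_append)
    ultimately show "R.walk u = R.walk v \<longleftrightarrow> R'.walk u = R'.walk v" using A unfolding agree_def by blast
  qed
next
  assume B: ?B
  show ?A unfolding agree_def
  proof (intro allI impI)
    fix w :: "nat list" assume w: "length w \<le> 2 * r"
    show "w \<in> stab k R \<longleftrightarrow> w \<in> stab k R'"
    proof (cases "w \<in> carrier (Gamma_group k)")
      case True
      define u v where "u = rev (take r w)" and "v = drop r w"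
      have uvw: "w = rev u @ v" by (simp add: u_def v_def)
      have uv: "set u \<subseteq> {..<k}" "set v \<subseteq> {..<k}" "length u \<le> r" "length v \<le> r"
        using True w set_take_subset[of r w] set_drop_subset[of r w] by (auto simp: u_def v_def carrier_Gamma)
      have "w \<in> stab k R \<longleftrightarrow> R.walk u = R.walk v"
        using True uv R.walk_eq_iff[of "rl_root R" "R.walk v" u] R.root R.walk_verts[of _ v]
        by (auto simp: stab_def uvw)
      moreover have "w \<in> stab k R' \<longleftrightarrow> R'.walk u = R'.walk v"
        using True uv R'.walk_eq_iff[of "rl_root R'" "R'.walk v" u] R'.root R'.walk_verts[of _ v]
        by (auto simp: stab_def uvw)
      ultimately show ?thesis using B uv by blast
    qed (auto simp: stab_def)
  qed
qed

text \<open>An edge of the ball has an end within distance m < r. Choosing a word of length at most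
  m for that end, the other end is reached by one more letter, so both ends are seen by walks of
  length at most r. One direction suffices, since the two graphs can be swapped.\<close>

lemma ball_edge_transfer:
  assumes eq: "\<And>u v. set u \<subseteq> {..<k} \<Longrightarrow> set v \<subseteq> {..<k} \<Longrightarrow> length u \<le> r \<Longrightarrow> length v \<le> r \<Longrightarrow>
       R.walk u = R.walk v \<Longrightarrow> R'.walk u = R'.walk v"
    and s: "set s \<subseteq> {..<k}" "length s \<le> r" and t: "set t \<subseteq> {..<k}" "length t \<le> r"
    and e: "(R.walk s, i, R.walk t) \<in> rl_edges (rl_ball R r)"
  shows "(R'.walk s, i, R'.walk t) \<in> rl_edges (rl_ball R' r)"
proof -
  have i: "i < k" using e R.edge_label by (auto simp: rl_ball_def)
  have *: "(R'.walk s, i, R'.walk t) \<in> rl_edges R' \<and> R'.walk s \<in> reach R' m"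
    if st: "set s \<subseteq> {..<k}" "length s \<le> r" "set t \<subseteq> {..<k}" "length t \<le> r"
      and ed: "(R.walk s, i, R.walk t) \<in> rl_edges R" and m: "m < r" "R.walk s \<in> reach R m" for s t m
  proof -
    obtain u where u: "set u \<subseteq> {..<k}" "length u \<le> m" "R.walk s = R.walk u"
      using m R.reach_eq by auto
    have su: "R'.walk s = R'.walk u" by (rule eq) (use st u m in auto)
    have "R.walk t = R.walk (i # u)" using ed u i R.edge_iff R.walk_verts R.root by auto
    then have "R'.walk t = R'.walk (i # u)" by (intro eq) (use st u m i in auto)
    then show ?thesis using su u i R'.edge_iff R'.walk_verts R'.root R'.reach_eq by auto
  qed
  obtain m where m: "m < r" "R.walk s \<in> reach R m \<or> R.walk t \<in> reach R m" "(R.walk s, i, R.walk t) \<in> rl_edges R"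
    using e by (auto simp: rl_ball_def)
  from m(2) show ?thesis
  proof
    assume "R.walk s \<in> reach R m"
    then show ?thesis using *[of s t m] s t m by (auto simp: rl_ball_def)
  next
    assume "R.walk t \<in> reach R m"
    then show ?thesis using *[of t s m] s t m R.edge_sym R'.edge_sym by (auto simp: rl_ball_def)
  qed
qed

lemma swap: "schreier_pair k R' R"
  by unfold_locales

text \<open>A rooted isomorphism has no freedom: it must send the end of a walk to the end of the
  same walk on the other side. So it exists exactly when walks of length at most r meet in the same
  way in both graphs.\<close>

lemma ball_iso_iff: "rl_iso (rl_ball R r) (rl_ball R' r) \<longleftrightarrow> agree (2 * r) (stab k R) (stab k R')"
proof
  let ?W = "{w. set w \<subseteq> {..<k} \<and> length w \<le> r}"
  assume "agree (2 * r) (stab k R) (stab k R')"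
  then have eq: "R.walk u = R.walk v \<longleftrightarrow> R'.walk u = R'.walk v" if "u \<in> ?W" "v \<in> ?W" for u v
    using that agree_iff_walks by auto
  then obtain f where f: "bij_betw f (R.walk ` ?W) (R'.walk ` ?W)" "\<And>u. u \<in> ?W \<Longrightarrow> f (R.walk u) = R'.walk u"
    using bij_betw_factor[of ?W R.walk R'.walk] by blast
  have "f (rl_root R) = rl_root R'" using f(2)[of "[]"] by simp
  moreover have "(x, i, y) \<in> rl_edges (rl_ball R r) \<longleftrightarrow> (f x, i, f y) \<in> rl_edges (rl_ball R' r)"
    if xy: "x \<in> R.walk ` ?W" "y \<in> R.walk ` ?W" for x y i
  proof -
    obtain s t where "s \<in> ?W" "t \<in> ?W" "x = R.walk s" "y = R.walk t" using xy by blast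
    then show ?thesis
      using f(2) eq ball_edge_transfer[of r s t i] schreier_pair.ball_edge_transfer[OF swap, of r s t i]
      by auto
  qed
  ultimately show "rl_iso (rl_ball R r) (rl_ball R' r)"
    using f(1) R.reach_eq R'.reach_eq unfolding rl_iso_def by (intro exI[of _ f]) (simp add: rl_ball_def)
next
  assume "rl_iso (rl_ball R r) (rl_ball R' r)"
  then obtain f where f: "bij_betw f (reach R r) (reach R' r)" "f (rl_root R) = rl_root R'"
    and e: "\<And>x y i. x \<in> reach R r \<Longrightarrow> y \<in> reach R r \<Longrightarrow>
        (x, i, y) \<in> rl_edges (rl_ball R r) \<longleftrightarrow> (f x, i, f y) \<in> rl_edges (rl_ball R' r)"
    unfolding rl_iso_def by (auto simp: rl_ball_def)
  have walk: "f (R.walk w) = R'.walk w" if "set w \<subseteq> {..<k}" "length w \<le> r" for w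
    using that
  proof (induction w)
    case (Cons i w)
    then have w: "set w \<subseteq> {..<k}" "length w < r" "i < k" by auto
    have in_reach: "R.walk w \<in> reach R (length w)" "R.walk w \<in> reach R r" "R.walk (i # w) \<in> reach R r"
      using w unfolding R.reach_eq by (blast, force, intro image_eqI[of _ _ "i # w"]) auto
    have "(R.walk w, i, R.walk (i # w)) \<in> rl_edges R"
      using w R.edge_iff R.walk_verts R.root by simp
    then have "(R.walk w, i, R.walk (i # w)) \<in> rl_edges (rl_ball R r)"
      using in_reach w by (auto simp: rl_ball_def)
    then have "(f (R.walk w), i, f (R.walk (i # w))) \<in> rl_edges (rl_ball R' r)"
      using e in_reach by blast
    then have "(R'.walk w, i, f (R.walk (i # w))) \<in> rl_edges R'"
      using Cons w by (simp add: rl_ball_def)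
    then show ?case using w R'.edge_iff R'.walk_verts R'.root by simp
  qed (simp add: f)
  show "agree (2 * r) (stab k R) (stab k R')"
    unfolding agree_iff_walks
  proof (intro allI impI)
    fix u v assume uv: "set u \<subseteq> {..<k}" "set v \<subseteq> {..<k}" "length u \<le> r" "length v \<le> r"
    then have "R.walk u \<in> reach R r" "R.walk v \<in> reach R r" unfolding R.reach_eq by auto
    then have "f (R.walk u) = f (R.walk v) \<longleftrightarrow> R.walk u = R.walk v"
      using f(1) by (auto simp: bij_betw_def inj_on_eq_iff)
    then show "R.walk u = R.walk v \<longleftrightarrow> R'.walk u = R'.walk v" using walk uv by simp
  qed
qed

lemma iso_iff: "rl_iso R R' \<longleftrightarrow> stab k R = stab k R'"
proof
  assume "rl_iso R R'"
  then obtain f where f: "bij_betw f (rl_verts R) (rl_verts R')" "f (rl_root R) = rl_root R'"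
    and e: "\<And>x y i. x \<in> rl_verts R \<Longrightarrow> y \<in> rl_verts R \<Longrightarrow>
        (x, i, y) \<in> rl_edges R \<longleftrightarrow> (f x, i, f y) \<in> rl_edges R'"
    unfolding rl_iso_def by blast
  have walk: "f (R.walk w) = R'.walk w" if "set w \<subseteq> {..<k}" for w
    using that
  proof (induction w)
    case (Cons i w)
    then have w: "set w \<subseteq> {..<k}" "i < k" by auto
    have "(f (R.walk w), i, f (R.walk (i # w))) \<in> rl_edges R'"
      using w R.edge_iff R.walk_verts R.root R.neighbour_verts by (subst e[symmetric]) auto
    then show ?case using w Cons R'.edge_iff R'.walk_verts R'.root by simp
  qed (simp add: f)
  have "R.walk w = rl_root R \<longleftrightarrow> R'.walk w = rl_root R'" if "set w \<subseteq> {..<k}" for w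
    using walk[OF that] f R.walk_verts[OF R.root that] R.root
    by (metis bij_betw_def inj_on_eq_iff)
  then show "stab k R = stab k R'" by (auto simp: stab_def carrier_Gamma)
next
  let ?W = "{w. set w \<subseteq> {..<k}}"
  assume eq: "stab k R = stab k R'"
  have eq: "R.walk u = R.walk v \<longleftrightarrow> R'.walk u = R'.walk v" if "u \<in> ?W" "v \<in> ?W" for u v
  proof -
    have "agree (2 * max (length u) (length v)) (stab k R) (stab k R')" by (simp add: eq agree_refl)
    then show ?thesis using that unfolding agree_iff_walks by auto
  qed
  then obtain f where f: "bij_betw f (R.walk ` ?W) (R'.walk ` ?W)" "\<And>u. u \<in> ?W \<Longrightarrow> f (R.walk u) = R'.walk u"
    using bij_betw_factor[of ?W R.walk R'.walk] by blast
  have V: "rl_verts R = R.walk ` ?W" "rl_verts R' = R'.walk ` ?W"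
    by (rule R.verts_eq, rule R'.verts_eq)
  have "f (rl_root R) = rl_root R'" using f(2)[of "[]"] by simp
  moreover have "(x, i, y) \<in> rl_edges R \<longleftrightarrow> (f x, i, f y) \<in> rl_edges R'"
    if xy: "x \<in> rl_verts R" "y \<in> rl_verts R" for x y i
  proof -
    obtain s t where st: "s \<in> ?W" "t \<in> ?W" "x = R.walk s" "y = R.walk t"
      using xy unfolding V by blast
    show ?thesis
    proof (cases "i < k")
      case True
      then show ?thesis
        using st f(2) R.edge_iff[of x i y] R'.edge_iff[of "f x" i "f y"] eq[of t "i # s"] V
        by auto
    next
      case False
      then show ?thesis using R.edge_label R'.edge_label by blast
    qed
  qed
  ultimately show "rl_iso R R'" using f(1) V unfolding rl_iso_def by (intro exI[of _ f]) simp
qed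

end

section \<open>The correspondence between subgroups and rooted Schreier graphs\<close>

text \<open>Well-formedness is a separate assumption because \<open>rl_iso\<close> compares edges
  between vertices only and would not notice stray edges of R'.\<close>

lemma schreier_transport:
  assumes "schreier k R" "rl_iso R R'" "wf_rlgraph R'" shows "schreier k R'"
proof -
  interpret schreier k R by fact
  obtain f where f: "bij_betw f (rl_verts R) (rl_verts R')" "f (rl_root R) = rl_root R'"
      and e: "\<And>x y i. x \<in> rl_verts R \<Longrightarrow> y \<in> rl_verts R \<Longrightarrow> (x, i, y) \<in> rl_edges R \<longleftrightarrow> (f x, i, f y) \<in> rl_edges R'"
    using assms(2) unfolding rl_iso_def by blast
  have V: "rl_verts R' = f ` rl_verts R" using f(1) by (simp add: bij_betw_def)
  have wfV: "x \<in> rl_verts R'" "y \<in> rl_verts R'" if "(x, i, y) \<in> rl_edges R'" for x i y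
    using that assms(3) by (auto simp: wf_rlgraph_def)
  have ed: "(f x, i, y) \<in> rl_edges R' \<longleftrightarrow> y = f (neighbour R i x)" if x: "x \<in> rl_verts R" "i < k" for x i y
  proof
    assume xy: "(f x, i, y) \<in> rl_edges R'"
    then obtain z where z: "z \<in> rl_verts R" "y = f z" using wfV(2) V by blast
    then have "(x, i, z) \<in> rl_edges R" using xy e[OF x(1) z(1)] by blast
    then have "z = neighbour R i x" using edge_iff[OF x] by blast
    then show "y = f (neighbour R i x)" using z(2) by simp
  next
    assume "y = f (neighbour R i x)"
    then show "(f x, i, y) \<in> rl_edges R'" using e[OF x(1) neighbour_verts[OF x]] edge_iff[OF x] by blast
  qed
  then have nb: "neighbour R' i (f x) = f (neighbour R i x)" if "x \<in> rl_verts R" "i < k" for x i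
    using that by (simp add: neighbour_def[of R'])
  have walk: "foldr (neighbour R') w (rl_root R') = f (walk w)" if "set w \<subseteq> {..<k}" for w
    using that by (induction w) (auto simp: f(2) nb walk_verts root)
  show ?thesis
  proof
    show "rl_root R' \<in> rl_verts R'" using imageI[OF root, of f] f(2) V by simp
    fix x i y assume xy: "(x, i, y) \<in> rl_edges R'"
    then show "x \<in> rl_verts R'" by (rule wfV)
    obtain u v where uv: "u \<in> rl_verts R" "v \<in> rl_verts R" "x = f u" "y = f v"
      using wfV[OF xy] V by blast
    then have "(u, i, v) \<in> rl_edges R" using xy e by blast
    then show "i < k" "(y, i, x) \<in> rl_edges R'" using edge_label edge_sym e uv by blast+
  next
    fix x and i :: nat assume "x \<in> rl_verts R'" "i < k"
    then show "\<exists>!y. (x, i, y) \<in> rl_edges R'" using V ed by auto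
  next
    fix x assume "x \<in> rl_verts R'"
    then obtain u where u: "u \<in> rl_verts R" "x = f u" using V by blast
    then obtain w where "set w \<subseteq> {..<k}" "u = walk w" using reachable by blast
    then show "\<exists>w. set w \<subseteq> {..<k} \<and> x = foldr (neighbour R') w (rl_root R')"
      using walk u by auto
  qed
qed

section \<open>Coset graphs and the stabilizers of their roots\<close>

lemma gen_Gamma: "i < k \<Longrightarrow> gen i \<in> carrier (Gamma_group k)"
  "gen i \<otimes>\<^bsub>Gamma_group k\<^esub> w = lmul i w"
  by (simp_all add: gen_def carrier_Gamma mult_Gamma)

context
  fixes k H assumes H: "subgroup H (Gamma_group k)"
begin

interpretation H: subgroup H "Gamma_group k" by (rule H)

lemma neighbour_schreier_graph:
  "i < k \<Longrightarrow> C \<in> lcosets\<^bsub>Gamma_group k\<^esub> H \<Longrightarrow>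
    neighbour (schreier_graph k H) i C = gen i <#\<^bsub>Gamma_group k\<^esub> C"
  by (simp add: neighbour_def schreier_graph_def)

lemma gen_lcoset:
  "a \<in> carrier (Gamma_group k) \<Longrightarrow> i < k \<Longrightarrow>
    gen i <#\<^bsub>Gamma_group k\<^esub> (a <#\<^bsub>Gamma_group k\<^esub> H) = lmul i a <#\<^bsub>Gamma_group k\<^esub> H"
  using Gamma.lcos_m_assoc[OF H.subset, of "gen i" a] by (simp add: gen_Gamma)

lemma lcosetsE:
  assumes "C \<in> lcosets\<^bsub>Gamma_group k\<^esub> H"
  obtains a where "a \<in> carrier (Gamma_group k)" "C = a <#\<^bsub>Gamma_group k\<^esub> H"
  using assms by (auto simp: LCOSETS_def)

lemma lcosetsI: "a \<in> carrier (Gamma_group k) \<Longrightarrow> a <#\<^bsub>Gamma_group k\<^esub> H \<in> lcosets\<^bsub>Gamma_group k\<^esub> H"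
  by (auto simp: LCOSETS_def)

lemma lmul_carrier: "a \<in> carrier (Gamma_group k) \<Longrightarrow> i < k \<Longrightarrow> lmul i a \<in> carrier (Gamma_group k)"
  using Gamma.m_closed[of "gen i" k a] by (simp add: gen_Gamma)

lemma walk_schreier_graph:
  "w \<in> carrier (Gamma_group k) \<Longrightarrow>
    foldr (neighbour (schreier_graph k H)) w H = w <#\<^bsub>Gamma_group k\<^esub> H"
proof (induction w)
  case Nil
  then show ?case using Gamma.lcos_mult_one[OF H.subset] by (simp add: one_Gamma)
next
  case (Cons i w)
  then have w: "w \<in> carrier (Gamma_group k)" "i < k" by (auto simp: carrier_Gamma distinct_adj_Cons)
  have "lmul i w = i # w" using Cons.prems by (cases w) (auto simp: carrier_Gamma lmul_def)
  then show ?case using Cons.IH[OF w(1)] w gen_lcoset[OF w]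
    by (simp add: neighbour_schreier_graph lcosetsI)
qed

lemma schreier_schreier_graph: "schreier k (schreier_graph k H)"
proof
  have H1: "H = \<one>\<^bsub>Gamma_group k\<^esub> <#\<^bsub>Gamma_group k\<^esub> H" using Gamma.lcos_mult_one[OF H.subset] by simp
  show "rl_root (schreier_graph k H) \<in> rl_verts (schreier_graph k H)"
    using lcosetsI[OF Gamma.one_closed] H1 by (simp add: schreier_graph_def)
  fix x i y assume e: "(x, i, y) \<in> rl_edges (schreier_graph k H)"
  then show "x \<in> rl_verts (schreier_graph k H)" "i < k" by (auto simp: schreier_graph_def)
  obtain a where a: "a \<in> carrier (Gamma_group k)" "x = a <#\<^bsub>Gamma_group k\<^esub> H" "i < k"
      "y = gen i <#\<^bsub>Gamma_group k\<^esub> x"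
    using e by (auto simp: schreier_graph_def elim: lcosetsE)
  then have "y = lmul i a <#\<^bsub>Gamma_group k\<^esub> H" using gen_lcoset by simp
  moreover from this have "gen i <#\<^bsub>Gamma_group k\<^esub> y = x"
    using a gen_lcoset[of "lmul i a" i] lmul_carrier by (simp add: lmul_lmul carrier_Gamma)
  ultimately show "(y, i, x) \<in> rl_edges (schreier_graph k H)"
    using a lcosetsI lmul_carrier by (auto simp: schreier_graph_def)
next
  fix x and i :: nat assume "x \<in> rl_verts (schreier_graph k H)" "i < k"
  then show "\<exists>!y. (x, i, y) \<in> rl_edges (schreier_graph k H)" by (auto simp: schreier_graph_def)
next
  fix x assume "x \<in> rl_verts (schreier_graph k H)"
  then obtain a where "a \<in> carrier (Gamma_group k)" "x = a <#\<^bsub>Gamma_group k\<^esub> H"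
    by (auto simp: schreier_graph_def elim: lcosetsE)
  then show "\<exists>w. set w \<subseteq> {..<k} \<and>
      x = foldr (neighbour (schreier_graph k H)) w (rl_root (schreier_graph k H))"
    using walk_schreier_graph[of a] by (auto simp: schreier_graph_def carrier_Gamma intro!: exI[of _ a])
qed

lemma stab_schreier_graph: "stab k (schreier_graph k H) = H"
proof -
  have "w \<in> stab k (schreier_graph k H) \<longleftrightarrow> w \<in> H" if w: "w \<in> carrier (Gamma_group k)" for w
  proof -
    have "w \<in> stab k (schreier_graph k H) \<longleftrightarrow> w <#\<^bsub>Gamma_group k\<^esub> H = H"
      using w walk_schreier_graph[OF w] by (simp add: stab_def schreier_graph_def)
    also have "\<dots> \<longleftrightarrow> w \<in> H"
    proof
      assume "w <#\<^bsub>Gamma_group k\<^esub> H = H"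
      moreover have "w \<otimes>\<^bsub>Gamma_group k\<^esub> \<one>\<^bsub>Gamma_group k\<^esub> \<in> w <#\<^bsub>Gamma_group k\<^esub> H"
        unfolding l_coset_def using H.one_closed by blast
      ultimately show "w \<in> H" using w by simp
    qed (use w H in \<open>rule Gamma.coset_join3\<close>)
    finally show ?thesis .
  qed
  then show ?thesis using H.subset by (auto simp: stab_def)
qed

text \<open>Replaces isomorphism classes by an equation between subgroups; injectivity, equivariance
  and the metric are all derived from it.\<close>

lemma mem_SchreierMap: "R \<in> SchreierMap k H \<longleftrightarrow> schreier k R \<and> stab k R = H"
proof
  assume "R \<in> SchreierMap k H"
  then have iso: "rl_iso (schreier_graph k H) R" "wf_rlgraph R"
    by (auto simp: SchreierMap_def sch_class_def)
  then have R: "schreier k R" by (rule schreier_transport[OF schreier_schreier_graph])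
  then interpret schreier_pair k "schreier_graph k H" R
    by (simp add: schreier_pair_def schreier_schreier_graph)
  show "schreier k R \<and> stab k R = H" using R iso_iff iso(1) stab_schreier_graph by simp
next
  assume R: "schreier k R \<and> stab k R = H"
  then interpret schreier_pair k "schreier_graph k H" R
    by (simp add: schreier_pair_def schreier_schreier_graph)
  show "R \<in> SchreierMap k H"
    using R iso_iff R'.wf stab_schreier_graph by (simp add: SchreierMap_def sch_class_def)
qed

end

lemma (in schreier) sch_class_eq: "sch_class R = SchreierMap k (stab k R)"
proof -
  interpret schreier_pair k R "schreier_graph k (stab k R)"
    by (intro schreier_pair.intro schreier_schreier_graph subgroup_stab) unfold_locales
  have iso: "rl_iso R (schreier_graph k (stab k R))"
    by (simp add: iso_iff stab_schreier_graph subgroup_stab)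
  then have "rl_iso (schreier_graph k (stab k R)) R" using root by (rule rl_iso_sym)
  then show ?thesis using iso unfolding SchreierMap_def sch_class_def by (auto intro: rl_iso_trans)
qed

lemma schreier_graph_mem_SchreierMap:
  "H \<in> Sub (Gamma_group k) \<Longrightarrow> schreier_graph k H \<in> SchreierMap k H"
  by (simp add: Sub_def mem_SchreierMap schreier_schreier_graph stab_schreier_graph)

lemma inj_on_SchreierMap: "inj_on (SchreierMap k) (Sub (Gamma_group k))"
proof (rule inj_onI)
  fix H H' assume HH: "H \<in> Sub (Gamma_group k)" "H' \<in> Sub (Gamma_group k)" "SchreierMap k H = SchreierMap k H'"
  then have "schreier_graph k H \<in> SchreierMap k H'"
    using schreier_graph_mem_SchreierMap by blast
  then show "H = H'" using HH by (simp add: Sub_def mem_SchreierMap stab_schreier_graph)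
qed

section \<open>Change of root corresponds to conjugation\<close>

lemma move_root_simps:
  "rl_verts (move_root g R) = rl_verts R" "rl_edges (move_root g R) = rl_edges R"
  "rl_root (move_root g R) = foldr (neighbour R) g (rl_root R)"
  "neighbour (move_root g R) = neighbour R"
  by (simp_all add: move_root_def neighbour_def fun_eq_iff)

lemma (in schreier) schreier_move_root:
  assumes "set g \<subseteq> {..<k}" shows "schreier k (move_root g R)"
proof (unfold_locales, unfold move_root_simps)
  show "walk g \<in> rl_verts R" using assms root by (simp add: walk_verts)
  fix x assume "x \<in> rl_verts R"
  then obtain w where "set w \<subseteq> {..<k}" "x = walk w" using reachable by blast
  then show "\<exists>w. set w \<subseteq> {..<k} \<and> x = foldr (neighbour R) w (walk g)"
    using assms walk_rev[OF root assms] by (intro exI[of _ "w @ rev g"]) simp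
qed (fact edge_verts edge_label edge_sym edge_ex1)+

lemma (in schreier) stab_move_root:
  assumes g: "g \<in> carrier (Gamma_group k)"
  shows "stab k (move_root g R) = conj_act (Gamma_group k) g (stab k R)"
proof (rule Set.set_eqI)
  fix w
  have sg: "set g \<subseteq> {..<k}" using g by (simp add: carrier_Gamma)
  have "foldr (neighbour R) w (walk g) = walk g \<longleftrightarrow>
      walk (inv\<^bsub>Gamma_group k\<^esub> g \<otimes>\<^bsub>Gamma_group k\<^esub> w \<otimes>\<^bsub>Gamma_group k\<^esub> g) = rl_root R"
    if "w \<in> carrier (Gamma_group k)"
  proof -
    have w: "set w \<subseteq> {..<k}" using that by (simp add: carrier_Gamma)
    have "walk (rev g \<otimes>\<^bsub>Gamma_group k\<^esub> w \<otimes>\<^bsub>Gamma_group k\<^esub> g) =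
        foldr (neighbour R) (rev g) (foldr (neighbour R) w (walk g))"
    proof -
      have "set (foldr lmul (rev g) w) \<subseteq> {..<k}" using set_foldr_lmul[of "rev g" w] w sg by auto
      then show ?thesis using w sg root by (simp add: mult_Gamma walk_mult walk_verts)
    qed
    moreover have "walk g = foldr (neighbour R) w (walk g) \<longleftrightarrow>
        rl_root R = foldr (neighbour R) (rev g) (foldr (neighbour R) w (walk g))"
      using w sg root by (intro walk_eq_iff) (auto simp: walk_verts)
    ultimately show ?thesis using g by (auto simp: inv_Gamma)
  qed
  then show "w \<in> stab k (move_root g R) \<longleftrightarrow> w \<in> conj_act (Gamma_group k) g (stab k R)"
    unfolding Gamma.mem_conj_act[OF stab_subset g] using g by (auto simp: stab_def move_root_simps)
qed

lemma conj_act_Sub: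
  "H \<in> Sub (Gamma_group k) \<Longrightarrow> g \<in> carrier (Gamma_group k) \<Longrightarrow>
    conj_act (Gamma_group k) g H \<in> Sub (Gamma_group k)"
  by (simp add: Sub_def Gamma.subgroup_conj_act)

lemma sch_act_SchreierMap:
  assumes H: "H \<in> Sub (Gamma_group k)" and g: "g \<in> carrier (Gamma_group k)"
  shows "sch_act g (SchreierMap k H) = SchreierMap k (conj_act (Gamma_group k) g H)"
proof -
  have sg: "set g \<subseteq> {..<k}" using g by (simp add: carrier_Gamma)
  have sub: "subgroup H (Gamma_group k)" "subgroup (conj_act (Gamma_group k) g H) (Gamma_group k)"
    using H conj_act_Sub[OF H g] by (simp_all add: Sub_def)
  have "move_root g R \<in> SchreierMap k (conj_act (Gamma_group k) g H)" if "R \<in> SchreierMap k H" for R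
    using that schreier.schreier_move_root[OF _ sg, of R] schreier.stab_move_root[OF _ g, of R]
    by (simp add: mem_SchreierMap sub)
  \<comment> \<open>For the reverse inclusion the root is moved back along \<open>rev g\<close>, the
    inverse of g.\<close>
  moreover have "R \<in> move_root g ` SchreierMap k H"
    if R: "R \<in> SchreierMap k (conj_act (Gamma_group k) g H)" for R
  proof
    have S: "schreier k R" "stab k R = conj_act (Gamma_group k) g H"
      using R by (simp_all add: mem_SchreierMap sub)
    interpret schreier k R by fact
    have rg: "rev g \<in> carrier (Gamma_group k)" "set (rev g) \<subseteq> {..<k}" using g by (simp_all add: carrier_Gamma)
    have "conj_act (Gamma_group k) (rev g) (conj_act (Gamma_group k) g H) = H"
      using Gamma.conj_act_mult[OF sub(1) rg(1) g] inv_Gamma[OF g] Gamma.l_inv[OF g] sub(1)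
      by (simp add: conj_act_def Gamma.lcos_mult_one subgroup.subset Gamma.coset_mult_one)
    then have "move_root (rev g) R \<in> SchreierMap k H"
      using schreier_move_root[OF rg(2)] stab_move_root[OF rg(1)] S by (simp add: mem_SchreierMap sub)
    moreover have "move_root g (move_root (rev g) R) = R"
      using walk_rev[OF root rg(2)] move_root_simps(4)[of "rev g" R] by (simp add: move_root_def)
    ultimately show "R = move_root g (move_root (rev g) R)" "move_root (rev g) R \<in> SchreierMap k H"
      by simp_all
  qed
  ultimately show ?thesis unfolding sch_act_def by blast
qed

section \<open>The metric on rooted Schreier graphs\<close>

lemma ball_iso_SchreierMap:
  assumes "H \<in> Sub (Gamma_group k)" "H' \<in> Sub (Gamma_group k)"
  shows "(\<exists>R\<in>SchreierMap k H. \<exists>R'\<in>SchreierMap k H'. rl_iso (rl_ball R r) (rl_ball R' r)) \<longleftrightarrow>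
    agree (2 * r) H H'"
proof -
  have iff: "rl_iso (rl_ball R r) (rl_ball R' r) \<longleftrightarrow> agree (2 * r) H H'"
    if R: "R \<in> SchreierMap k H" "R' \<in> SchreierMap k H'" for R R'
  proof -
    have S: "schreier k R" "stab k R = H" "schreier k R'" "stab k R' = H'"
      using R assms by (simp_all add: Sub_def mem_SchreierMap)
    then show ?thesis using schreier_pair.ball_iso_iff[of k R R' r] by (simp add: schreier_pair_def)
  qed
  show ?thesis
    using iff schreier_graph_mem_SchreierMap[OF assms(1)] schreier_graph_mem_SchreierMap[OF assms(2)]
    by blast
qed

text \<open>For distinct subgroups the admissible radii contain 0, are closed downwards and are
  bounded by the length of any word that separates the subgroups, so \<open>GREATEST\<close> really
  is a maximum.\<close>

lemma sch_dist_le_iff: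
  assumes H: "H \<in> Sub (Gamma_group k)" "H' \<in> Sub (Gamma_group k)"
  shows "sch_dist (SchreierMap k H) (SchreierMap k H') \<le> (1/2) ^ r \<longleftrightarrow> agree (2 * r) H H'"
proof (cases "H = H'")
  case True
  then show ?thesis by (simp add: sch_dist_def agree_refl)
next
  case False
  let ?P = "\<lambda>r. agree (2 * r) H H'"
  from False obtain w where w: "w \<in> H \<longleftrightarrow> w \<notin> H'" by blast
  have bound: "r \<le> length w" if "?P r" for r
  proof (rule ccontr)
    assume "\<not> r \<le> length w"
    then have "length w \<le> 2 * r" by simp
    then show False using that w unfolding agree_def by blast
  qed
  have "[] \<in> H" "[] \<in> H'"
    using H subgroup.one_closed[of _ "Gamma_group k", unfolded one_Gamma] by (auto simp: Sub_def)
  then have P0: "?P 0" by (simp add: agree_def)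
  have "SchreierMap k H \<noteq> SchreierMap k H'" using False H inj_on_SchreierMap by (auto dest: inj_onD)
  then have d: "sch_dist (SchreierMap k H) (SchreierMap k H') = (1/2) ^ (GREATEST r. ?P r)"
    by (simp add: sch_dist_def ball_iso_SchreierMap[OF H])
  have G: "?P (GREATEST r. ?P r)" by (rule GreatestI_nat[of ?P, OF P0 bound])
  have "?P r \<longleftrightarrow> r \<le> (GREATEST r. ?P r)"
  proof
    assume "?P r"
    then show "r \<le> (GREATEST r. ?P r)" by (rule Greatest_le_nat[of ?P, OF _ bound])
  next
    assume "r \<le> (GREATEST r. ?P r)"
    then show "?P r" by (intro agree_mono[OF G]) simp
  qed
  then show ?thesis unfolding d by (simp add: power_decreasing_iff)
qed

lemma sch_dist_cases: "sch_dist P Q = 0 \<and> P = Q \<or> (\<exists>r. sch_dist P Q = (1/2) ^ r \<and> P \<noteq> Q)"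
  by (auto simp: sch_dist_def)

lemma Metric_space_Sch: "Metric_space (Sch k) sch_dist"
proof
  show "0 \<le> sch_dist x y" for x y by (simp add: sch_dist_def)
  \<comment> \<open>\<open>Metric_space\<close> asks for symmetry at all arguments, not only on
    \<open>Sch k\<close>, so it comes from \<open>rl_iso\<close> itself rather than from
    \<open>agree\<close>.\<close>
  have "rl_iso (rl_ball R r) (rl_ball R' r) \<longleftrightarrow> rl_iso (rl_ball R' r) (rl_ball R r)"
    for R R' :: "nat list set rlgraph" and r
  proof -
    have "rl_root S \<in> reach S r" for S :: "nat list set rlgraph" by (induction r) auto
    then show ?thesis using rl_iso_sym by (force simp: rl_ball_def)
  qed
  then have "(\<exists>R\<in>x. \<exists>R'\<in>y. rl_iso (rl_ball R r) (rl_ball R' r)) \<longleftrightarrow>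
      (\<exists>R\<in>y. \<exists>R'\<in>x. rl_iso (rl_ball R r) (rl_ball R' r))" for x y :: "nat list set rlgraph set" and r
    by blast
  then show "sch_dist x y = sch_dist y x" for x y by (simp only: sch_dist_def eq_commute[of x y])
  show "sch_dist x y = 0 \<longleftrightarrow> x = y" for x y by (simp add: sch_dist_def)
  fix x y z assume xyz: "x \<in> Sch k" "y \<in> Sch k" "z \<in> Sch k"
  then obtain A B C where H: "A \<in> Sub (Gamma_group k)" "B \<in> Sub (Gamma_group k)" "C \<in> Sub (Gamma_group k)"
      "x = SchreierMap k A" "y = SchreierMap k B" "z = SchreierMap k C"
    by (auto simp: Sch_def)
  have pos: "0 \<le> sch_dist u v" for u v by (simp add: sch_dist_def)
  consider "x = y" | "y = z" | r s where "sch_dist x y = (1/2) ^ r" "sch_dist y z = (1/2) ^ s"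
    using sch_dist_cases[of x y] sch_dist_cases[of y z] by blast
  then show "sch_dist x z \<le> sch_dist x y + sch_dist y z"
  proof cases
    case 3
    \<comment> \<open>The distance is an ultrametric: agreement up to the smaller of the two radii
      is transitive.\<close>
    let ?m = "min r s"
    have "(1/2::real) ^ r \<le> (1/2) ^ ?m" "(1/2::real) ^ s \<le> (1/2) ^ ?m" by (simp_all add: power_decreasing)
    then have "agree (2 * ?m) A B" "agree (2 * ?m) B C"
      using 3 H sch_dist_le_iff[of A k B ?m] sch_dist_le_iff[of B k C ?m] by simp_all
    then have "agree (2 * ?m) A C" by (rule agree_trans)
    then have "sch_dist x z \<le> (1/2) ^ ?m" using H sch_dist_le_iff[of A k C ?m] by simp
    also have "\<dots> \<le> (1/2) ^ r + (1/2) ^ s" by (auto simp: min_def)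
    finally show ?thesis using 3 by simp
  qed (use pos in \<open>simp_all add: sch_dist_def\<close>)
qed

lemma topspace_Sch: "topspace (Sch_topology k) = Sch k"
  by (simp add: Sch_topology_def Metric_space.topspace_mtopology[OF Metric_space_Sch])

lemma SchreierMap_closure:
  assumes H: "H \<in> Sub (Gamma_group k)" and N: "N \<subseteq> Sub (Gamma_group k)"
  shows "SchreierMap k H \<in> Sch_topology k closure_of (SchreierMap k ` N) \<longleftrightarrow>
    (\<forall>n. \<exists>H'\<in>N. agree n H H')"
proof -
  interpret Metric_space "Sch k" sch_dist by (rule Metric_space_Sch)
  have S: "SchreierMap k H' \<in> Sch k" if "H' \<in> Sub (Gamma_group k)" for H' using that by (simp add: Sch_def)
  have "SchreierMap k H \<in> Sch_topology k closure_of (SchreierMap k ` N) \<longleftrightarrow>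
      (\<forall>r>0. \<exists>H'\<in>N. sch_dist (SchreierMap k H) (SchreierMap k H') < r)"
    using S H N by (auto simp: Sch_topology_def metric_closure_of subset_iff)
  also have "\<dots> \<longleftrightarrow> (\<forall>n. \<exists>H'\<in>N. agree n H H')"
  proof safe
    fix n :: nat assume "\<forall>r>0. \<exists>H'\<in>N. sch_dist (SchreierMap k H) (SchreierMap k H') < r"
    then obtain H' where "H' \<in> N" "sch_dist (SchreierMap k H) (SchreierMap k H') < (1/2) ^ n"
      by (meson zero_less_power half_gt_zero_iff zero_less_one)
    then have "agree (2 * n) H H'" using sch_dist_le_iff[OF H, of H' n] N by auto
    then show "\<exists>H'\<in>N. agree n H H'" 
      using \<open>H' \<in> N\<close> agree_mono[of "2 * n" H H' n] by auto
  next
    fix r :: real assume "r > 0" and ag: "\<forall>n. \<exists>H'\<in>N. agree n H H'"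
    then obtain n where n: "(1/2) ^ n < r" using real_arch_pow_inv[of r "1/2"] by auto
    obtain H' where "H' \<in> N" "agree (2 * n) H H'" using ag by blast
    then show "\<exists>H'\<in>N. sch_dist (SchreierMap k H) (SchreierMap k H') < r"
      using sch_dist_le_iff[OF H, of H' n] N n by force
  qed
  finally show ?thesis .
qed

section \<open>The topology on subgroups and the transfer of minimality\<close>

lemma topspace_Sub: "topspace (Sub_topology (Gamma_group k)) = Sub (Gamma_group k)"
  by (auto simp: Sub_topology_def topspace_pullback_topology)

text \<open>The criterion is the one of \<open>SchreierMap_closure\<close>. Both topologies thus
  have the same closed sets, which is all that is used of the homeomorphism.\<close>

lemma Sub_closure:
  assumes H: "H \<in> Sub (Gamma_group k)" and N: "N \<subseteq> Sub (Gamma_group k)"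
  shows "H \<in> Sub_topology (Gamma_group k) closure_of N \<longleftrightarrow> (\<forall>n. \<exists>H'\<in>N. agree n H H')"
proof
  let ?C = "carrier (Gamma_group k)"
  let ?T = "product_topology (\<lambda>_. discrete_topology (UNIV :: bool set)) ?C"
  let ?\<chi> = "\<lambda>H. \<lambda>g\<in>?C. g \<in> H"
  have sub: "K \<subseteq> ?C" if "K \<in> Sub (Gamma_group k)" for K
    using that by (simp add: Sub_def subgroup.subset)
  {
    assume cl: "H \<in> Sub_topology (Gamma_group k) closure_of N"
    then have cl_open: "\<exists>H'. H' \<in> N \<and> H' \<in> T"
      if "H \<in> T" "openin (Sub_topology (Gamma_group k)) T" for T
      using that by (simp add: in_closure_of)
    show "\<forall>n. \<exists>H'\<in>N. agree n H H'"
    proof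
      fix n
      let ?F = "{w \<in> ?C. length w \<le> n}"
      let ?U = "{f \<in> ?C \<rightarrow>\<^sub>E UNIV. \<forall>w\<in>?F. f w = (w \<in> H)}"
      have "?F \<subseteq> {w. set w \<subseteq> {..<k} \<and> length w \<le> n}" by (auto simp: carrier_Gamma)
      then have "finite ?F" using finite_lists_length_le[of "{..<k}" n] finite_subset by auto
      then have "openin ?T ?U" by (rule openin_product_discrete) auto
      then have "openin (Sub_topology (Gamma_group k)) (?\<chi> -` ?U \<inter> Sub (Gamma_group k))"
        unfolding Sub_topology_def openin_pullback_topology by blast
      moreover have "H \<in> ?\<chi> -` ?U \<inter> Sub (Gamma_group k)" using H by auto
      ultimately have "\<exists>H'. H' \<in> N \<and> H' \<in> ?\<chi> -` ?U \<inter> Sub (Gamma_group k)" by (intro cl_open)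
      then obtain H' where H': "H' \<in> N" "?\<chi> H' \<in> ?U" by (elim exE conjE IntE) (rule that, simp_all only: vimage_eq)
      then have "w \<in> H' \<longleftrightarrow> w \<in> H" if "length w \<le> n" for w
        using that sub[OF H] sub[of H'] N by (cases "w \<in> ?C") auto
      then show "\<exists>H'\<in>N. agree n H H'" using H'(1) unfolding agree_def by blast
    qed
  next
    assume ag: "\<forall>n. \<exists>H'\<in>N. agree n H H'"
    show "H \<in> Sub_topology (Gamma_group k) closure_of N" unfolding in_closure_of
    proof (intro conjI allI impI)
      fix T assume "H \<in> T \<and> openin (Sub_topology (Gamma_group k)) T"
      then obtain U where U: "openin ?T U" "T = ?\<chi> -` U \<inter> Sub (Gamma_group k)" "?\<chi> H \<in> U"
        unfolding Sub_topology_def openin_pullback_topology by auto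
      then obtain B where "finite {i \<in> ?C. B i \<noteq> topspace (discrete_topology (UNIV :: bool set))}"
          and B': "?\<chi> H \<in> Pi\<^sub>E ?C B" "Pi\<^sub>E ?C B \<subseteq> U"
        using bspec[OF U(1)[unfolded openin_product_topology_alt] U(3)] by blast
      then have B: "finite {i \<in> ?C. B i \<noteq> UNIV}" by simp
      \<comment> \<open>A basic open set restricts finitely many words, and n bounds their lengths;
        the inserted 0 covers the case of no restriction.\<close>
      define n where "n = Max (insert 0 (length ` {i \<in> ?C. B i \<noteq> UNIV}))"
      obtain H' where H': "H' \<in> N" "agree n H H'" using ag by blast
      have "?\<chi> H' i \<in> B i" if i: "i \<in> ?C" for i
      proof (cases "B i = UNIV")
        case False
        then have "length i \<le> n" unfolding n_def using B i by (intro Max_ge) auto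
        then have "i \<in> H' \<longleftrightarrow> i \<in> H" using H'(2) by (auto simp: agree_def)
        then show ?thesis using PiE_mem[OF B'(1) i] i by simp
      qed simp
      then have "?\<chi> H' \<in> Pi\<^sub>E ?C B" by (auto simp: PiE_iff)
      then show "\<exists>y. y \<in> N \<and> y \<in> T" using H' B'(2) U(2) N by blast
    qed (simp add: topspace_Sub H)
  }
qed

lemma closedin_iff_closure_points:
  assumes "S \<subseteq> topspace X"
  shows "closedin X S \<longleftrightarrow> (\<forall>x\<in>topspace X. x \<in> X closure_of S \<longrightarrow> x \<in> S)"
  using assms closure_of_subset_eq[of S X] closure_of_subset_topspace[of X S] by blast

text \<open>\<open>SchreierMap k\<close> is injective on subgroups with image \<open>Sch k\<close>,
  and it preserves and reflects closedness and invariance, so each clause of minimality carries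
  over.\<close>

lemma URS_of_minimal_subsystem:
  assumes M: "minimal_subsystem (Gamma_group k) (Sch_topology k) sch_act M"
  shows "URS (Gamma_group k) {H \<in> Sub (Gamma_group k). SchreierMap k H \<in> M}" 
proof -
  define Z where "Z = {H \<in> Sub (Gamma_group k). SchreierMap k H \<in> M}"
  have closed_iff: "closedin (Sch_topology k) (SchreierMap k ` N) \<longleftrightarrow>
      closedin (Sub_topology (Gamma_group k)) N" if N: "N \<subseteq> Sub (Gamma_group k)" for N
  proof -
    have "closedin (Sch_topology k) (SchreierMap k ` N) \<longleftrightarrow>
        (\<forall>H\<in>Sub (Gamma_group k). SchreierMap k H \<in> Sch_topology k closure_of (SchreierMap k ` N) \<longrightarrow>
          SchreierMap k H \<in> SchreierMap k ` N)"
      using N by (subst closedin_iff_closure_points) (auto simp: topspace_Sch Sch_def)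
    also have "\<dots> \<longleftrightarrow> (\<forall>H\<in>Sub (Gamma_group k). H \<in> Sub_topology (Gamma_group k) closure_of N \<longrightarrow> H \<in> N)"
      using N by (auto simp: SchreierMap_closure Sub_closure inj_on_image_mem_iff[OF inj_on_SchreierMap])
    also have "\<dots> \<longleftrightarrow> closedin (Sub_topology (Gamma_group k)) N"
      using N by (subst closedin_iff_closure_points) (auto simp: topspace_Sub)
    finally show ?thesis .
  qed
  have inv_iff: "(\<forall>g\<in>carrier (Gamma_group k). sch_act g ` SchreierMap k ` N \<subseteq> SchreierMap k ` N) \<longleftrightarrow>
      (\<forall>g\<in>carrier (Gamma_group k). conj_act (Gamma_group k) g ` N \<subseteq> N)"
    if N: "N \<subseteq> Sub (Gamma_group k)" for N
  proof -
    have "sch_act g (SchreierMap k H) \<in> SchreierMap k ` N \<longleftrightarrow> conj_act (Gamma_group k) g H \<in> N"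
      if "g \<in> carrier (Gamma_group k)" "H \<in> N" for g H
      using that N conj_act_Sub[of H k g]
      by (auto simp: sch_act_SchreierMap subset_iff inj_on_image_mem_iff[OF inj_on_SchreierMap])
    then show ?thesis by (simp add: image_subset_iff)
  qed
  have Z: "Z \<subseteq> Sub (Gamma_group k)" by (auto simp: Z_def)
  have "M \<subseteq> Sch k" using M closedin_subset topspace_Sch by (metis minimal_subsystem_def)
  then have MZ: "M = SchreierMap k ` Z" by (auto simp: Sch_def Z_def)
  have inv: "\<forall>g\<in>carrier (Gamma_group k). sch_act g ` SchreierMap k ` Z \<subseteq> SchreierMap k ` Z"
    and closed: "closedin (Sch_topology k) (SchreierMap k ` Z)" and ne: "Z \<noteq> {}"
    using M unfolding MZ minimal_subsystem_def by simp_all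
  have min: "SchreierMap k ` N = SchreierMap k ` Z"
    if "N \<subseteq> Z" "N \<noteq> {}" "closedin (Sch_topology k) (SchreierMap k ` N)"
      "\<forall>g\<in>carrier (Gamma_group k). sch_act g ` SchreierMap k ` N \<subseteq> SchreierMap k ` N" for N
    using M that image_mono[OF that(1), of "SchreierMap k"] unfolding MZ minimal_subsystem_def by simp
  show ?thesis unfolding URS_def minimal_subsystem_def Z_def[symmetric]
  proof (intro conjI allI impI)
    show "closedin (Sub_topology (Gamma_group k)) Z" using closed by (simp only: closed_iff[OF Z])
    show "\<forall>g\<in>carrier (Gamma_group k). conj_act (Gamma_group k) g ` Z \<subseteq> Z"
      using inv by (simp only: inv_iff[OF Z])
    fix N assume N: "N \<subseteq> Z \<and> N \<noteq> {} \<and> closedin (Sub_topology (Gamma_group k)) N \<and>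
        (\<forall>g\<in>carrier (Gamma_group k). conj_act (Gamma_group k) g ` N \<subseteq> N)"
    then have NS: "N \<subseteq> Sub (Gamma_group k)" using Z by blast
    have "SchreierMap k ` N = SchreierMap k ` Z"
    proof (rule min, unfold closed_iff[OF NS] inv_iff[OF NS])
      show "\<forall>g\<in>carrier (Gamma_group k). conj_act (Gamma_group k) g ` N \<subseteq> N" using N by blast
    qed (use N in simp_all)
    then show "N = Z" by (simp only: inj_on_image_eq_iff[OF inj_on_SchreierMap NS Z])
  qed (fact ne)
qed

section \<open>Self-normalizing subgroups\<close>

lemma (in group) conj_act_one: "subgroup H G \<Longrightarrow> conj_act G \<one> H = H"
  by (simp add: conj_act_def lcos_mult_one coset_mult_one subgroup.subset)

lemma (in group) conj_act_inv_fix: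
  assumes "subgroup H G" "x \<in> carrier G" "conj_act G x H = H" shows "conj_act G (inv x) H = H"
  using conj_act_mult[OF assms(1), of "inv x" x] conj_act_one[OF assms(1)] assms by simp

lemma (in group) conj_act_mem:
  assumes "subgroup H G" "h \<in> H" shows "conj_act G h H = H"
proof -
  have h: "h \<in> carrier G" using assms by (rule subgroup.mem_carrier)
  then show ?thesis using assms subgroup.m_inv_closed[OF assms]
    by (simp add: conj_act_def coset_join3 coset_join2)
qed

text \<open>If aH and bH give the same conjugate, then the inverse of b times a normalizes H, hence
  lies in H, and the cosets are equal.\<close>

lemma (in group) coset_conj_bij:
  assumes H: "subgroup H G" and self: "\<And>g. g \<in> carrier G \<Longrightarrow> conj_act G g H = H \<Longrightarrow> g \<in> H"
  shows "bij_betw (coset_conj G H) (lcosets H) (orbit G (conj_act G) H)"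
  unfolding bij_betw_def
proof
  show "coset_conj G H ` (lcosets H) = orbit G (conj_act G) H"
    using coset_conj_eq[OF H] by (auto simp: orbit_def LCOSETS_def)
  show "inj_on (coset_conj G H) (lcosets H)"
  proof (rule inj_onI)
    fix C D assume "C \<in> lcosets H" "D \<in> lcosets H" and eq: "coset_conj G H C = coset_conj G H D"
    then obtain a b where ab: "a \<in> carrier G" "C = a <# H" "b \<in> carrier G" "D = b <# H"
      by (auto simp: LCOSETS_def)
    let ?h = "inv b \<otimes> a"
    have "conj_act G ?h H = conj_act G (inv b) (conj_act G b H)"
      using ab eq by (simp add: coset_conj_eq[OF H] conj_act_mult[OF H])
    also have "\<dots> = H" using ab conj_act_mult[OF H, of "inv b" b] by (simp add: conj_act_one[OF H])
    finally have h: "?h \<in> H" using ab by (intro self) auto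
    have "a <# H = b \<otimes> ?h <# H" using ab by (simp add: inv_mult_cancel)
    also have "\<dots> = b <# (?h <# H)"
      using ab H by (intro lcos_m_assoc[symmetric]) (auto simp: subgroup.subset)
    also have "?h <# H = H" using ab H h by (intro coset_join3) auto
    finally show "C = D" using ab by simp
  qed
qed

lemma length_inv_Gamma:
  "w \<in> carrier (Gamma_group k) \<Longrightarrow> length (inv\<^bsub>Gamma_group k\<^esub> w) = length w"
  by (simp add: inv_Gamma)

text \<open>Conjugating a word by the inverse of g lengthens it by at most twice the length of
  g.\<close>

lemma agree_conj_act:
  assumes "agree (n + 2 * length g) H H'" "H \<subseteq> carrier (Gamma_group k)" "H' \<subseteq> carrier (Gamma_group k)"
    and g: "g \<in> carrier (Gamma_group k)"
  shows "agree n (conj_act (Gamma_group k) g H) (conj_act (Gamma_group k) g H')"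
  unfolding agree_def Gamma.mem_conj_act[OF assms(2) g] Gamma.mem_conj_act[OF assms(3) g]
proof (intro allI impI)
  fix x :: "nat list" assume x: "length x \<le> n"
  let ?y = "inv\<^bsub>Gamma_group k\<^esub> g \<otimes>\<^bsub>Gamma_group k\<^esub> x \<otimes>\<^bsub>Gamma_group k\<^esub> g"
  have "length ?y \<le> length (inv\<^bsub>Gamma_group k\<^esub> g) + length x + length g"
    by (intro order_trans[OF length_mult_Gamma] add_right_mono length_mult_Gamma)
  then have "length ?y \<le> n + 2 * length g" using x length_inv_Gamma[OF g] by simp
  then show "(x \<in> carrier (Gamma_group k) \<and> ?y \<in> H) = (x \<in> carrier (Gamma_group k) \<and> ?y \<in> H')"
    using assms(1) unfolding agree_def by blast
qed

lemma drop_carrier: "w \<in> carrier (Gamma_group k) \<Longrightarrow> drop i w \<in> carrier (Gamma_group k)"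
  using set_drop_subset[of i w] distinct_adj_appendD2[of "take i w" "drop i w"]
  by (auto simp: carrier_Gamma)

lemma take_carrier: "w \<in> carrier (Gamma_group k) \<Longrightarrow> take i w \<in> carrier (Gamma_group k)"
  using set_take_subset[of i w] distinct_adj_appendD1[of "take i w" "drop i w"]
  by (auto simp: carrier_Gamma)

text \<open>Two suffixes of a word differ by the segment between their starting points.
  Geometrically, vertices i and j of a path are at distance at most j - i.\<close>

lemma length_drop_mult_inv:
  assumes w: "w \<in> carrier (Gamma_group k)" and ij: "i \<le> j"
  shows "length (drop i w \<otimes>\<^bsub>Gamma_group k\<^esub> inv\<^bsub>Gamma_group k\<^esub> (drop j w)) \<le> j - i"
    and "length (drop j w \<otimes>\<^bsub>Gamma_group k\<^esub> inv\<^bsub>Gamma_group k\<^esub> (drop i w)) \<le> j - i"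
proof -
  let ?G = "Gamma_group k" and ?u = "take (j - i) (drop i w)"
  have c: "drop i w \<in> carrier ?G" "drop j w \<in> carrier ?G" "?u \<in> carrier ?G"
    using w by (auto intro: drop_carrier take_carrier)
  have app: "drop i w = ?u @ drop j w"
    using append_take_drop_id[of "j - i" "drop i w"] ij by simp
  then have "?u \<otimes>\<^bsub>?G\<^esub> drop j w = drop i w"
    using c(1) mult_Gamma_append[of ?u "drop j w" k] by (simp add: carrier_Gamma)
  then have eq: "drop i w \<otimes>\<^bsub>?G\<^esub> inv\<^bsub>?G\<^esub> (drop j w) = ?u"
    using c by (metis Gamma.inv_solve_right)
  then show "length (drop i w \<otimes>\<^bsub>?G\<^esub> inv\<^bsub>?G\<^esub> (drop j w)) \<le> j - i" by simp
  have "drop j w \<otimes>\<^bsub>?G\<^esub> inv\<^bsub>?G\<^esub> (drop i w) = inv\<^bsub>?G\<^esub> ?u"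
    using c unfolding eq[symmetric] by (simp add: Gamma.inv_mult_group)
  then show "length (drop j w \<otimes>\<^bsub>?G\<^esub> inv\<^bsub>?G\<^esub> (drop i w)) \<le> j - i"
    using c by (simp add: length_inv_Gamma)
qed

text \<open>
  In the Schreier graph of H the element w moves the root by an automorphism, and the minimality
  hypothesis says that no vertex is moved closer than the length of w by a nontrivial automorphism.
\<close>

locale minimal_normalizing = H: subgroup H "Gamma_group k" for k H +
  fixes w :: "nat list"
  assumes w: "w \<in> carrier (Gamma_group k)" "w \<notin> H" and w_norm: "conj_act (Gamma_group k) w H = H"
    and w_min: "\<And>b z. b \<in> carrier (Gamma_group k) \<Longrightarrow> z \<in> carrier (Gamma_group k) \<Longrightarrow> z \<notin> H \<Longrightarrow>
      conj_act (Gamma_group k) z H = H \<Longrightarrow>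
      length w \<le> length (b \<otimes>\<^bsub>Gamma_group k\<^esub> z \<otimes>\<^bsub>Gamma_group k\<^esub> inv\<^bsub>Gamma_group k\<^esub> b)"
begin

abbreviation G where "G \<equiv> Gamma_group k"

text \<open>Words act from right to left, so the suffix of length j leads from the root to vertex j
  of the path that w traces.\<close>

abbreviation suffix :: "nat \<Rightarrow> nat list" where "suffix j \<equiv> drop (length w - j) w"

lemma H_subgroup: "subgroup H G"
  by unfold_locales

lemma suffix_carrier: "suffix j \<in> carrier G"
  using w(1) by (rule drop_carrier)

text \<open>If vertices i and j coincided, the loop between them could be skipped: the rest of the
  path, then the image of its first i steps, leads from this vertex to its image in (length w - j) +
  i steps, too few for minimality.\<close>

lemma suffix_diff_notin:
  assumes "i < j" "j < length w" shows "inv\<^bsub>G\<^esub> (suffix i) \<otimes>\<^bsub>G\<^esub> suffix j \<notin> H"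
proof
  let ?a = "suffix i" and ?b = "suffix j"
  assume h: "inv\<^bsub>G\<^esub> ?a \<otimes>\<^bsub>G\<^esub> ?b \<in> H" (is "?h \<in> H")
  let ?z = "w \<otimes>\<^bsub>G\<^esub> inv\<^bsub>G\<^esub> ?h"
  have c: "?a \<in> carrier G" "?b \<in> carrier G" by (rule suffix_carrier)+
  have z: "?z \<in> carrier G" using w(1) c by simp
  have "?z \<notin> H"
  proof
    assume "?z \<in> H"
    then have "?z \<otimes>\<^bsub>G\<^esub> ?h \<in> H" using h by (rule H.m_closed)
    moreover have "?z \<otimes>\<^bsub>G\<^esub> ?h = w" using w(1) c by (simp add: Gamma.m_assoc)
    ultimately show False using w(2) by simp
  qed
  moreover have "conj_act G ?z H = H"
    using w(1) c w_norm Gamma.conj_act_mem[OF H_subgroup H.m_inv_closed[OF h]]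
    by (simp add: Gamma.conj_act_mult[OF H_subgroup])
  ultimately have "length w \<le> length (?a \<otimes>\<^bsub>G\<^esub> ?z \<otimes>\<^bsub>G\<^esub> inv\<^bsub>G\<^esub> ?a)"
    using z c by (intro w_min)
  also have "?a \<otimes>\<^bsub>G\<^esub> ?z \<otimes>\<^bsub>G\<^esub> inv\<^bsub>G\<^esub> ?a = ?a \<otimes>\<^bsub>G\<^esub> (w \<otimes>\<^bsub>G\<^esub> inv\<^bsub>G\<^esub> ?b)"
    using w(1) c by (simp add: Gamma.m_assoc Gamma.inv_mult_group)
  also have "length \<dots> \<le> length ?a + length (w \<otimes>\<^bsub>G\<^esub> inv\<^bsub>G\<^esub> ?b)" by (rule length_mult_Gamma)
  also have "\<dots> \<le> i + (length w - j)"
    using length_drop_mult_inv(1)[OF w(1), of 0 "length w - j"] assms by simp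
  also have "\<dots> < length w" using assms by simp
  finally show False by simp
qed

text \<open>If the image of vertex j were vertex i, some nontrivial automorphism would displace a
  vertex of the path only along the path itself, by less than the length of w.\<close>

lemma suffix_diff_mult_notin:
  assumes "i < length w" "j < length w" shows "inv\<^bsub>G\<^esub> (suffix i) \<otimes>\<^bsub>G\<^esub> (suffix j \<otimes>\<^bsub>G\<^esub> w) \<notin> H"
proof
  let ?a = "suffix i" and ?b = "suffix j"
  assume h: "inv\<^bsub>G\<^esub> ?a \<otimes>\<^bsub>G\<^esub> (?b \<otimes>\<^bsub>G\<^esub> w) \<in> H" (is "?h \<in> H")
  let ?z = "inv\<^bsub>G\<^esub> ?a \<otimes>\<^bsub>G\<^esub> ?b"
  have c: "?a \<in> carrier G" "?b \<in> carrier G" by (rule suffix_carrier)+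
  have "w = inv\<^bsub>G\<^esub> ?z \<otimes>\<^bsub>G\<^esub> ?h"
    using w(1) c by (simp add: Gamma.m_assoc Gamma.inv_mult_group Gamma.inv_mult_cancel)
  then have "?z \<notin> H" using h w(2) by (metis H.m_closed H.m_inv_closed)
  moreover have "conj_act G ?z H = H"
  proof -
    have "?z = ?h \<otimes>\<^bsub>G\<^esub> inv\<^bsub>G\<^esub> w" using w(1) c by (simp add: Gamma.m_assoc)
    then show ?thesis
      using w(1) c Gamma.conj_act_inv_fix[OF H_subgroup w(1) w_norm] Gamma.conj_act_mem[OF H_subgroup h]
        Gamma.conj_act_mult[OF H_subgroup, of ?h "inv\<^bsub>G\<^esub> w"] by simp
  qed
  ultimately have "length w \<le> length (?a \<otimes>\<^bsub>G\<^esub> ?z \<otimes>\<^bsub>G\<^esub> inv\<^bsub>G\<^esub> ?a)"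
    using c by (intro w_min) auto
  also have "?a \<otimes>\<^bsub>G\<^esub> ?z \<otimes>\<^bsub>G\<^esub> inv\<^bsub>G\<^esub> ?a = ?b \<otimes>\<^bsub>G\<^esub> inv\<^bsub>G\<^esub> ?a"
    using c by (simp add: Gamma.m_assoc Gamma.inv_mult_cancel)
  also have "length \<dots> < length w"
  proof (cases "i \<le> j")
    case True
    then show ?thesis
      using length_drop_mult_inv(1)[OF w(1) diff_le_mono2[OF True, of "length w"]] assms by linarith
  next
    case False
    then have "j \<le> i" by simp
    then show ?thesis
      using length_drop_mult_inv(2)[OF w(1) diff_le_mono2[of j i "length w"]] assms by linarith
  qed
  finally show False by simp
qed

text \<open>As w normalizes H, the root moved along w has the same stabilizer; this is the
  automorphism, and walks meet after w exactly as they do before it. In the doubled path the first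
  half runs through the suffixes of w and the second half through their images.\<close>

lemma walks_along_square:
  assumes R: "schreier k R" "stab k R = H"
  shows "\<And>u v. set u \<subseteq> {..<k} \<Longrightarrow> set v \<subseteq> {..<k} \<Longrightarrow>
      foldr (neighbour R) (u @ w) (rl_root R) = foldr (neighbour R) (v @ w) (rl_root R) \<longleftrightarrow>
      foldr (neighbour R) u (rl_root R) = foldr (neighbour R) v (rl_root R)"
    and "\<And>i j. i < j \<Longrightarrow> j < 2 * length w \<Longrightarrow>
      foldr (neighbour R) (if i < length w then suffix i else suffix (i - length w) @ w) (rl_root R) \<noteq>
      foldr (neighbour R) (if j < length w then suffix j else suffix (j - length w) @ w) (rl_root R)"
proof -
  interpret schreier k R by (rule R)
  have sw: "set w \<subseteq> {..<k}" using w by (simp add: carrier_Gamma)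
  have sx: "set (suffix i) \<subseteq> {..<k}" for i using suffix_carrier[of i] by (simp add: carrier_Gamma)
  interpret P: schreier_pair k R "move_root w R"
    by (intro schreier_pair.intro R schreier_move_root sw)
  have st: "stab k (move_root w R) = stab k R" using stab_move_root[OF w(1)] w_norm R by simp
  show shift: "walk (u @ w) = walk (v @ w) \<longleftrightarrow> walk u = walk v"
    if "set u \<subseteq> {..<k}" "set v \<subseteq> {..<k}" for u v
  proof -
    have "agree (2 * max (length u) (length v)) (stab k R) (stab k (move_root w R))"
      by (simp add: st agree_refl)
    then show ?thesis using that unfolding P.agree_iff_walks by (auto simp: move_root_simps)
  qed
  have suf: "walk (suffix i) \<noteq> walk (suffix j)" if "i < j" "j < length w" for i j
    using mem_stab[OF suffix_carrier suffix_carrier] suffix_diff_notin[OF that] R by simp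
  have mixed: "walk (suffix i) \<noteq> walk (suffix j @ w)" if "i < length w" "j < length w" for i j
    using mem_stab[OF suffix_carrier Gamma.m_closed[OF suffix_carrier w(1)]]
      suffix_diff_mult_notin[OF that] R walk_mult[OF root sx sw] by (simp add: mult_Gamma)
  show "walk (if i < length w then suffix i else suffix (i - length w) @ w) \<noteq>
      walk (if j < length w then suffix j else suffix (j - length w) @ w)"
    if "i < j" "j < 2 * length w" for i j
  proof (cases "j < length w")
    case True
    then show ?thesis using that suf by simp
  next
    case False
    show ?thesis
    proof (cases "i < length w")
      case True
      then show ?thesis using mixed[of i "j - length w"] False that by simp
    next
      case False
      then show ?thesis
        using that suf[of "i - length w" "j - length w"] \<open>\<not> j < length w\<close>
          shift[OF sx[of "i - length w"] sx[of "j - length w"]] by simp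
    qed
  qed
qed

end

text \<open>Of the labels only \<open>color_eq\<close> is retained, namely that a label determines
  the pair of end colours; how pairs are encoded as numbers stays outside the argument.\<close>

locale nonrepetitive_edge_coloring =
  fixes V :: "'a set" and E :: "'a set set" and k :: nat and c :: "'a set \<Rightarrow> nat" and f :: "'a \<Rightarrow> nat"
  assumes simple: "simple_graph V E" and connected: "connected_graph V E" and infinite: "infinite V"
    and proper: "proper_edge_coloring E k c"
    and color_eq: "e \<in> E \<Longrightarrow> e' \<in> E \<Longrightarrow> c e = c e' \<Longrightarrow> f ` e = f ` e'"
    and neighbours_distinct: "{x, y} \<in> E \<Longrightarrow> {x, z} \<in> E \<Longrightarrow> y \<noteq> z \<Longrightarrow> f y \<noteq> f z"
    and nonrepetitive: "distinct p \<Longrightarrow> successively (\<lambda>x y. {x, y} \<in> E) p \<Longrightarrow> \<not> repetitive f p"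
begin

abbreviation act :: "nat \<Rightarrow> 'a \<Rightarrow> 'a" where
  "act \<equiv> color_act E c"

abbreviation graph_at :: "'a \<Rightarrow> 'a rlgraph" where
  "graph_at v \<equiv> colored_schreier_graph V E k c v"

lemma edge_verts:
  assumes "{x, y} \<in> E" shows "x \<in> V \<and> y \<in> V \<and> x \<noteq> y"
proof -
  obtain u v where "u \<in> V" "v \<in> V" "u \<noteq> v" "{x, y} = {u, v}"
    using simple assms unfolding simple_graph_def by blast
  then show ?thesis by (auto simp: doubleton_eq_iff)
qed

lemma color_neq:
  "e \<in> E \<Longrightarrow> e' \<in> E \<Longrightarrow> e \<noteq> e' \<Longrightarrow> e \<inter> e' \<noteq> {} \<Longrightarrow> c e \<noteq> c e'"
  using proper by (simp add: proper_edge_coloring_def)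

lemma act_edge:
  assumes "{x, y} \<in> E" shows "act (c {x, y}) x = y"
proof -
  have "z = y" if "{x, z} \<in> E" "c {x, z} = c {x, y}" for z
  proof (rule ccontr)
    assume "z \<noteq> y"
    then have "{x, z} \<noteq> {x, y}" by (auto simp: doubleton_eq_iff)
    then show False using color_neq[OF that(1) assms] that(2) by simp
  qed
  then have "(THE z. {x, z} \<in> E \<and> c {x, z} = c {x, y}) = y" using assms by (intro the_equality) auto
  then show ?thesis using assms by (auto simp: color_act_def)
qed

lemma edge_act:
  assumes "act i x \<noteq> x" shows "{x, act i x} \<in> E" "c {x, act i x} = i"
proof -
  obtain y where y: "{x, y} \<in> E" "c {x, y} = i"
    using assms unfolding color_act_def by (auto split: if_splits)
  then have "act i x = y" using act_edge[OF y(1)] by simp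
  then show "{x, act i x} \<in> E" "c {x, act i x} = i" using y by simp_all
qed

lemma act_verts: "x \<in> V \<Longrightarrow> act i x \<in> V"
  using edge_act[of i x] edge_verts by metis

lemma act_act: "act i (act i x) = x"
  using edge_act[of i x] act_edge[of "act i x" x] by (cases "act i x = x") (auto simp: insert_commute)

lemma act_eq_iff: "act i x = y \<longleftrightarrow> x = act i y"
  using act_act[of i] by metis

lemma neighbour_graph_at: "x \<in> V \<Longrightarrow> i < k \<Longrightarrow> neighbour (graph_at v) i x = act i x"
  by (simp add: neighbour_def colored_schreier_graph_def)

lemma color_less: "e \<in> E \<Longrightarrow> c e < k"
  using proper by (auto simp: proper_edge_coloring_def)

lemma walk_graph_at:
  "x \<in> V \<Longrightarrow> set w \<subseteq> {..<k} \<Longrightarrow> foldr (neighbour (graph_at v)) w x = foldr act w x \<and> foldr act w x \<in> V"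
  by (induction w) (auto simp: neighbour_graph_at act_verts)

lemma schreier_graph_at:
  assumes v: "v \<in> V" shows "schreier k (graph_at v)"
proof
  show "rl_root (graph_at v) \<in> rl_verts (graph_at v)" using v by (simp add: colored_schreier_graph_def)
  fix x i y assume "(x, i, y) \<in> rl_edges (graph_at v)"
  then show "x \<in> rl_verts (graph_at v)" "i < k" "(y, i, x) \<in> rl_edges (graph_at v)"
    by (auto simp: colored_schreier_graph_def act_act act_verts)
next
  fix x and i :: nat assume "x \<in> rl_verts (graph_at v)" "i < k"
  then show "\<exists>!y. (x, i, y) \<in> rl_edges (graph_at v)" by (auto simp: colored_schreier_graph_def)
next
  fix x assume "x \<in> rl_verts (graph_at v)"
  then have "(v, x) \<in> {(u, v). {u, v} \<in> E}\<^sup>*"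
    using connected v by (auto simp: connected_graph_def colored_schreier_graph_def)
  then have "\<exists>w. set w \<subseteq> {..<k} \<and> x = foldr act w v"
  proof (induction rule: rtrancl_induct)
    case base
    show ?case by (rule exI[of _ "[]"]) simp
  next
    case (step y z)
    then obtain w where "set w \<subseteq> {..<k}" "y = foldr act w v" by blast
    then show ?case using step.hyps act_edge[of y z] color_less[of "{y, z}"]
      by (intro exI[of _ "c {y, z} # w"]) auto
  qed
  then show "\<exists>w. set w \<subseteq> {..<k} \<and> x = foldr (neighbour (graph_at v)) w (rl_root (graph_at v))"
    using walk_graph_at[OF v] by (auto simp: colored_schreier_graph_def)
qed

lemma move_root_graph_at:
  assumes "v \<in> V" "set g \<subseteq> {..<k}" shows "move_root g (graph_at v) = graph_at (foldr act g v)"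
  using walk_graph_at[OF assms, of v] by (simp add: move_root_def colored_schreier_graph_def)

text \<open>The label of the edge from x to z also occurs at y and names the same pair of colours
  there. Since x and y have different colours, the pair can only be matched crosswise.\<close>

lemma swapped_colors:
  assumes "\<And>i. i < k \<Longrightarrow> act i x = x \<longleftrightarrow> act i y = y" "f x \<noteq> f y" "{x, z} \<in> E"
  shows "f z = f y" "f (act (c {x, z}) y) = f x"
proof -
  let ?i = "c {x, z}"
  have z: "act ?i x = z" "z \<noteq> x" using act_edge[OF assms(3)] edge_verts[OF assms(3)] by auto
  then have "act ?i y \<noteq> y" using assms(1)[OF color_less[OF assms(3)]] by auto
  then have "f ` {x, z} = f ` {y, act ?i y}"
    using edge_act[of ?i y] assms(3) by (intro color_eq) auto
  then show "f z = f y" "f (act ?i y) = f x" using assms(2) by (auto simp: doubleton_eq_iff)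
qed

lemma neighbour_exists:
  assumes "x \<in> V" obtains y where "{x, y} \<in> E"
proof -
  have "\<not> V \<subseteq> {x}" using infinite finite_subset by blast
  then obtain y where "y \<in> V" "y \<noteq> x" by blast
  then have "(x, y) \<in> {(u, v). {u, v} \<in> E}\<^sup>*" "x \<noteq> y" using connected assms by (auto simp: connected_graph_def)
  then show ?thesis using that by (auto elim: converse_rtranclE)
qed

text \<open>
  The colours of the edges at a vertex and at its neighbours determine the colour of the vertex:
  otherwise the two colours are exchanged along every edge, so that neither the vertex nor its
  neighbour has a second neighbour.
\<close>

lemma vertex_color_determined:
  assumes V: "x \<in> V" "y \<in> V"
    and fix_iff: "\<And>u. set u \<subseteq> {..<k} \<Longrightarrow> length u \<le> 3 \<Longrightarrow> foldr act u x = x \<longleftrightarrow> foldr act u y = y"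
  shows "f x = f y"
proof (rule ccontr)
  assume neq: "f x \<noteq> f y"
  have fx: "act i x = x \<longleftrightarrow> act i y = y" if "i < k" for i using fix_iff[of "[i]"] that by simp
  obtain z where z: "{x, z} \<in> E" using neighbour_exists[OF V(1)] .
  let ?i = "c {x, z}"
  have i: "?i < k" using color_less[OF z] .
  have xz: "act ?i x = z" using act_edge[OF z] .
  let ?z' = "act ?i y"
  \<comment> \<open>Whether the label m is a loop at z is tested from x by going to z, along m, and
    back; this is where words of length 3 are needed.\<close>
  have fz: "act m z = z \<longleftrightarrow> act m ?z' = ?z'" if m: "m < k" for m
  proof -
    have "act m z = z \<longleftrightarrow> foldr act [?i, m, ?i] x = x" 
      using xz act_eq_iff[of ?i "act m z" x] by simp
    also have "\<dots> \<longleftrightarrow> foldr act [?i, m, ?i] y = y" by (rule fix_iff) (use i m in auto)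
    also have "\<dots> \<longleftrightarrow> act m ?z' = ?z'" 
      using act_eq_iff[of ?i "act m ?z'" y] by simp
    finally show ?thesis .
  qed
  have "f z = f y" "f ?z' = f x" using swapped_colors[OF fx neq z] by auto
  then have neq': "f z \<noteq> f ?z'" using neq by simp
  \<comment> \<open>Every neighbour of x gets the colour of y, while distinct neighbours of x have
    distinct colours.\<close>
  have Nx: "u = z" if "{x, u} \<in> E" for u
    using swapped_colors(1)[OF fx neq that] swapped_colors(1)[OF fx neq z] neighbours_distinct[OF that z] by auto
  have zx: "{z, x} \<in> E" using z by (simp add: insert_commute)
  have Nz: "u = x" if "{z, u} \<in> E" for u
    using swapped_colors(1)[OF fz neq' that] swapped_colors(1)[OF fz neq' zx] neighbours_distinct[OF that zx] by auto
  have "u \<in> {x, z}" if "(x, u) \<in> {(u, v). {u, v} \<in> E}\<^sup>*" for u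
    using that by (induction rule: rtrancl_induct) (auto dest: Nx Nz)
  then have "V \<subseteq> {x, z}" using connected V(1) by (auto simp: connected_graph_def)
  then show False using infinite finite_subset by blast
qed

lemma no_minimal_normalizing:
  assumes approx: "\<And>n. \<exists>v\<in>V. agree n H (stab k (graph_at v))"
  shows "\<not> minimal_normalizing k H w"
proof
  assume "minimal_normalizing k H w"
  then interpret minimal_normalizing k H w .
  let ?n = "length w" and ?R = "schreier_graph k H"
  define s where "s j = (if j < ?n then suffix j else suffix (j - ?n) @ w)" for j
  \<comment> \<open>Words for the doubled path have length at most 2n; the 3 leaves room for the
    test words of \<open>vertex_color_determined\<close>, and the outer 2 comes from
    \<open>agree_iff_walks\<close>.\<close>
  obtain v where v: "v \<in> V" "agree (2 * (2 * ?n + 3)) H (stab k (graph_at v))" using approx by blast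
  have R: "schreier k ?R" "stab k ?R = H"
    using schreier_schreier_graph stab_schreier_graph H_subgroup by auto
  interpret P: schreier_pair k ?R "graph_at v"
    by (intro schreier_pair.intro R schreier_graph_at v)
  have root: "rl_root (graph_at v) = v" by (simp add: colored_schreier_graph_def)
  have transfer: "P.R.walk a = P.R.walk b \<longleftrightarrow> foldr act a v = foldr act b v"
    if "set a \<subseteq> {..<k}" "set b \<subseteq> {..<k}" "length a \<le> 2 * ?n + 3" "length b \<le> 2 * ?n + 3" for a b
  proof -
    have "agree (2 * (2 * ?n + 3)) (stab k ?R) (stab k (graph_at v))" using v(2) by (simp only: R(2))
    then have "P.R.walk a = P.R.walk b \<longleftrightarrow> P.R'.walk a = P.R'.walk b"
      using that unfolding P.agree_iff_walks by blast
    then show ?thesis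
      using walk_graph_at[OF v(1) that(1), of v] walk_graph_at[OF v(1) that(2), of v] by (simp only: root)
  qed
  have sw: "set w \<subseteq> {..<k}" using w by (simp add: carrier_Gamma)
  have sx: "set (suffix i) \<subseteq> {..<k}" for i using suffix_carrier[of i] by (simp add: carrier_Gamma)
  have ss: "set (s i) \<subseteq> {..<k}" "length (s i) \<le> 2 * ?n" for i
    using sw sx[of i] sx[of "i - ?n"] by (auto simp: s_def)
  define q where "q j = foldr act (s j) v" for j
  have qV: "q j \<in> V" for j using walk_graph_at[OF v(1) ss(1)] by (simp add: q_def)
  have n: "?n > 0" using w(2) H.one_closed by (auto simp: one_Gamma)
  have neq: "q i \<noteq> q j" if "i < j" "j < 2 * ?n" for i j
    using walks_along_square(2)[OF R that] transfer[OF ss(1) ss(1), of i j] ss(2)[of i] ss(2)[of j]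
    unfolding q_def s_def by simp
  have suffix_Suc: "suffix (Suc j) = w ! (?n - Suc j) # suffix j" if "j < ?n" for j
    using that Cons_nth_drop_Suc[of "?n - Suc j" w] by (simp add: Suc_diff_Suc)
  have step: "\<exists>i. q (Suc j) = act i (q j)" if "Suc j < 2 * ?n" for j
  proof (cases "j < ?n")
    case True
    \<comment> \<open>At the junction of the two halves \<open>suffix ?n\<close> and
      \<open>suffix 0 @ w\<close> are the same word w.\<close>
    then have "q (Suc j) = foldr act (suffix (Suc j)) v"
      by (cases "Suc j < ?n") (auto simp: q_def s_def not_less le_Suc_eq)
    then show ?thesis using suffix_Suc[OF True] True by (auto simp: q_def s_def)
  next
    case False
    then have "suffix (Suc j - ?n) = w ! (?n - Suc (j - ?n)) # suffix (j - ?n)"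
      using suffix_Suc[of "j - ?n"] that by (simp add: Suc_diff_le)
    then show ?thesis using False by (auto simp: q_def s_def)
  qed
  let ?p = "map q [0..<2 * ?n]"
  have "inj_on q {0..<2 * ?n}" by (rule linorder_inj_onI) (use neq in auto)
  then have "distinct ?p" by (simp add: distinct_map)
  moreover have "successively (\<lambda>x y. {x, y} \<in> E) ?p"
    unfolding successively_conv_nth
  proof (intro allI impI)
    fix j assume "Suc j < length ?p"
    then have j: "Suc j < 2 * ?n" by simp
    then obtain i where i: "q (Suc j) = act i (q j)" using step by blast
    \<comment> \<open>Injectivity rules out that a letter acts as a loop, so each step is a genuine
      edge of G.\<close>
    have "act i (q j) \<noteq> q j" using neq[OF lessI j] i by metis
    then have "{q j, q (Suc j)} \<in> E" using edge_act(1)[of i "q j"] i by simp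
    then show "{?p ! j, ?p ! Suc j} \<in> E" using j by simp
  qed
  moreover have "repetitive f ?p"
  proof -
    \<comment> \<open>Vertices j and n + j correspond under the automorphism, so the same short
      words close up at both, in the Schreier graph and therefore in G.\<close>
    have same: "f (q j) = f (q (?n + j))" if j: "j < ?n" for j
    proof (rule vertex_color_determined[OF qV qV])
      fix u assume u: "set u \<subseteq> {..<k}" "length u \<le> 3"
      have qq: "q j = foldr act (suffix j) v" "q (?n + j) = foldr act (suffix j @ w) v"
        using j by (auto simp: q_def s_def)
      have "foldr act u (q j) = q j \<longleftrightarrow> P.R.walk (u @ suffix j) = P.R.walk (suffix j)"
        using transfer[of "u @ suffix j" "suffix j"] u sx[of j] qq by simp
      also have "\<dots> \<longleftrightarrow> P.R.walk ((u @ suffix j) @ w) = P.R.walk (suffix j @ w)"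
        using walks_along_square(1)[OF R, of "u @ suffix j" "suffix j"] u sx[of j] by simp
      also have "\<dots> \<longleftrightarrow> foldr act u (q (?n + j)) = q (?n + j)"
        using transfer[of "(u @ suffix j) @ w" "suffix j @ w"] u sx[of j] sw qq j by simp
      finally show "foldr act u (q j) = q j \<longleftrightarrow> foldr act u (q (?n + j)) = q (?n + j)" .
    qed
    have "[0..<2 * ?n] = [0..<?n] @ [?n..<?n + ?n]" using upt_add_eq_append[of 0 ?n ?n] by (simp add: mult_2)
    also have "[?n..<?n + ?n] = map (\<lambda>j. ?n + j) [0..<?n]" using map_add_upt[of ?n ?n] by (simp add: add.commute)
    finally have "map f ?p = map (f \<circ> q) [0..<?n] @ map (f \<circ> q) (map (\<lambda>j. ?n + j) [0..<?n])" by simp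
    also have "map (f \<circ> q) (map (\<lambda>j. ?n + j) [0..<?n]) = map (f \<circ> q) [0..<?n]"
      using same by simp
    finally show ?thesis unfolding repetitive_def using n by (intro exI[of _ "map (f \<circ> q) [0..<?n]"]) simp
  qed
  ultimately show False using nonrepetitive by blast
qed

text \<open>The pair of a base vertex b and a normalizing z outside H with the shortest displacement
  is chosen; conjugating by the base moves the root there and produces the situation of
  \<open>minimal_normalizing\<close>.\<close>

lemma self_normalizing:
  assumes H: "subgroup H (Gamma_group k)"
    and approx: "\<And>n. \<exists>v\<in>V. agree n H (stab k (graph_at v))"
    and g: "g \<in> carrier (Gamma_group k)" "conj_act (Gamma_group k) g H = H"
  shows "g \<in> H"
proof (rule ccontr)
  let ?G = "Gamma_group k"
  assume "g \<notin> H"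
  define P where "P = (\<lambda>(b, z). b \<in> carrier ?G \<and> z \<in> carrier ?G \<and> z \<notin> H \<and> conj_act ?G z H = H)"
  define m where "m = (\<lambda>(b, z). length (b \<otimes>\<^bsub>?G\<^esub> z \<otimes>\<^bsub>?G\<^esub> inv\<^bsub>?G\<^esub> b))"
  have "P (\<one>\<^bsub>?G\<^esub>, g)" using g \<open>g \<notin> H\<close> by (simp add: P_def)
  then obtain p where p: "P p" "\<And>p'. P p' \<Longrightarrow> m p \<le> m p'"
    using exists_least_iff[of "\<lambda>n. \<exists>p. P p \<and> m p = n"] by (metis not_less)
  obtain a z where az: "p = (a, z)" by (cases p)
  have a: "a \<in> carrier ?G" and z: "z \<in> carrier ?G" "z \<notin> H" "conj_act ?G z H = H"
    using p(1) by (auto simp: P_def az)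
  let ?H = "conj_act ?G a H" and ?w = "a \<otimes>\<^bsub>?G\<^esub> z \<otimes>\<^bsub>?G\<^esub> inv\<^bsub>?G\<^esub> a"
  have Hs: "H \<subseteq> carrier ?G" using H by (rule subgroup.subset)
  have H': "subgroup ?H ?G" using H a by (rule Gamma.subgroup_conj_act)
  have ia: "inv\<^bsub>?G\<^esub> a \<in> carrier ?G" using a by simp
  have unconj: "conj_act ?G (inv\<^bsub>?G\<^esub> a) ?H = H"
    using Gamma.conj_act_mult[OF H ia a] Gamma.conj_act_one[OF H] a by simp
  have mem: "x \<in> ?H \<longleftrightarrow> inv\<^bsub>?G\<^esub> a \<otimes>\<^bsub>?G\<^esub> x \<otimes>\<^bsub>?G\<^esub> a \<in> H" if "x \<in> carrier ?G" for x
    using that Gamma.mem_conj_act[OF Hs a] by simp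
  have "minimal_normalizing k ?H ?w"
  proof (intro minimal_normalizing.intro minimal_normalizing_axioms.intro H')
    show "?w \<in> carrier ?G" using a z by simp
    then show "?w \<notin> ?H" using a z by (simp add: mem Gamma.m_assoc Gamma.inv_mult_cancel)
    show "conj_act ?G ?w ?H = ?H"
      using a z ia unconj Gamma.conj_act_mult[OF H'] Gamma.conj_act_mult[OF H] by simp
    fix b y assume b: "b \<in> carrier ?G" and y: "y \<in> carrier ?G" "y \<notin> ?H" "conj_act ?G y ?H = ?H"
    let ?y = "inv\<^bsub>?G\<^esub> a \<otimes>\<^bsub>?G\<^esub> y \<otimes>\<^bsub>?G\<^esub> a"
    have "?y \<notin> H" using y mem by simp
    moreover have "conj_act ?G ?y H = H"
      using Gamma.conj_act_mult[OF H, of "inv\<^bsub>?G\<^esub> a \<otimes>\<^bsub>?G\<^esub> y" a] Gamma.conj_act_mult[OF H', of "inv\<^bsub>?G\<^esub> a" y]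
        a ia y unconj by simp
    \<comment> \<open>A competitor at base b for the conjugate is a competitor at base ba for H,
      with the same displacement.\<close>
    ultimately have "P (b \<otimes>\<^bsub>?G\<^esub> a, ?y)" using a b y by (simp add: P_def)
    from p(2)[OF this] have "length ?w \<le> length (b \<otimes>\<^bsub>?G\<^esub> a \<otimes>\<^bsub>?G\<^esub> ?y \<otimes>\<^bsub>?G\<^esub> inv\<^bsub>?G\<^esub> (b \<otimes>\<^bsub>?G\<^esub> a))"
      by (simp add: m_def az)
    also have "b \<otimes>\<^bsub>?G\<^esub> a \<otimes>\<^bsub>?G\<^esub> ?y \<otimes>\<^bsub>?G\<^esub> inv\<^bsub>?G\<^esub> (b \<otimes>\<^bsub>?G\<^esub> a) = b \<otimes>\<^bsub>?G\<^esub> y \<otimes>\<^bsub>?G\<^esub> inv\<^bsub>?G\<^esub> b"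
      using a b y by (simp add: Gamma.m_assoc Gamma.inv_mult_group Gamma.inv_mult_cancel)
    finally show "length ?w \<le> length (b \<otimes>\<^bsub>?G\<^esub> y \<otimes>\<^bsub>?G\<^esub> inv\<^bsub>?G\<^esub> b)" .
  qed
  moreover have "\<exists>v\<in>V. agree n ?H (stab k (graph_at v))" for n
  proof -
    \<comment> \<open>The extra \<open>2 * length a\<close> pays for conjugation by a, which turns
      the base point v into another vertex of G.\<close>
    obtain v where v: "v \<in> V" "agree (n + 2 * length a) H (stab k (graph_at v))" using approx by blast
    interpret schreier k "graph_at v" using v(1) by (rule schreier_graph_at)
    have sa: "set a \<subseteq> {..<k}" using a by (simp add: carrier_Gamma)
    have "agree n ?H (conj_act ?G a (stab k (graph_at v)))"
      using v(2) Hs stab_subset a by (rule agree_conj_act)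
    then have "agree n ?H (stab k (graph_at (foldr act a v)))"
      using stab_move_root[OF a] move_root_graph_at[OF v(1) sa] by simp
    then show ?thesis using walk_graph_at[OF v(1) sa] by blast
  qed
  ultimately show False using no_minimal_normalizing by blast
qed

text \<open>The orbit consists of rerootings of the coloured graph, so the subgroups that
  approximate H are stabilizers of vertices of G.\<close>

lemma approx_of_orbit_closure:
  assumes H: "H \<in> Sub (Gamma_group k)" and x: "x \<in> V"
    and cl: "SchreierMap k H \<in> orbit_closure V E k c x"
  shows "\<exists>v\<in>V. agree n H (stab k (graph_at v))"
proof -
  let ?G = "Gamma_group k"
  interpret schreier k "graph_at x" using x by (rule schreier_graph_at)
  let ?S = "stab k (graph_at x)"
  have S: "?S \<in> Sub ?G" using subgroup_stab by (simp add: Sub_def)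
  let ?N = "(\<lambda>g. conj_act ?G g ?S) ` carrier ?G"
  have "orbit ?G sch_act (sch_class (graph_at x)) = SchreierMap k ` ?N"
    using sch_act_SchreierMap[OF S] by (auto simp: orbit_def sch_class_eq image_image)
  then have "SchreierMap k H \<in> Sch_topology k closure_of (SchreierMap k ` ?N)"
    using cl by (simp add: orbit_closure_def)
  moreover have "?N \<subseteq> Sub ?G" using conj_act_Sub[OF S] by blast
  ultimately obtain g where g: "g \<in> carrier ?G" "agree n H (conj_act ?G g ?S)"
    using SchreierMap_closure[OF H, of ?N] by blast
  have sg: "set g \<subseteq> {..<k}" using g by (simp add: carrier_Gamma)
  show ?thesis
    using g(2) stab_move_root[OF g(1)] move_root_graph_at[OF x sg] walk_graph_at[OF x sg]
    by (intro bexI[of _ "foldr act g x"]) simp_all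
qed

lemma generic:
  assumes x: "x \<in> V" and M: "M \<subseteq> orbit_closure V E k c x"
    "minimal_subsystem (Gamma_group k) (Sch_topology k) sch_act M"
  shows "generic_URS (Gamma_group k) {H \<in> Sub (Gamma_group k). SchreierMap k H \<in> M}"
  unfolding generic_URS_def
proof (intro conjI ballI)
  show "URS (Gamma_group k) {H \<in> Sub (Gamma_group k). SchreierMap k H \<in> M}"
    using M(2) by (rule URS_of_minimal_subsystem)
  fix H assume "H \<in> {H \<in> Sub (Gamma_group k). SchreierMap k H \<in> M}"
  then have H: "H \<in> Sub (Gamma_group k)" "SchreierMap k H \<in> orbit_closure V E k c x" using M by auto
  then have "subgroup H (Gamma_group k)" by (simp add: Sub_def)
  then show "bij_betw (coset_conj (Gamma_group k) H) (lcosets\<^bsub>Gamma_group k\<^esub> H)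
      (orbit (Gamma_group k) (conj_act (Gamma_group k)) H)"
    using self_normalizing approx_of_orbit_closure[OF H(1) x H(2)]
    by (intro Gamma.coset_conj_bij) auto
qed

end

section \<open>Construction of the edge colouring\<close>

lemma set_encode_less:
  assumes "A \<subseteq> {..<n}" shows "set_encode A < 2 ^ n"
proof -
  have "set_encode A \<le> (\<Sum>i<n. 2 ^ i)" unfolding set_encode_def using assms by (intro sum_mono2) auto
  also have "\<dots> < 2 ^ n" by (induction n) auto
  finally show ?thesis .
qed

lemma square_bounded_degree:
  assumes "simple_graph V E" "bounded_degree V E"
  obtains D where
    "bounded_degree_graph (\<lambda>x. {y. {x, y} \<in> E} \<union> (\<Union>z\<in>{z. {x, z} \<in> E}. {y. {z, y} \<in> E})) D"
proof -
  obtain d where d: "\<And>x. x \<in> V \<Longrightarrow> finite {e \<in> E. x \<in> e} \<and> card {e \<in> E. x \<in> e} \<le> d"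
    using assms(2) unfolding bounded_degree_def by blast
  let ?N = "\<lambda>x. {y. {x, y} \<in> E}"
  have N: "finite (?N x) \<and> card (?N x) \<le> d" for x
  proof (cases "x \<in> V")
    case True
    have inj: "inj_on (\<lambda>y. {x, y}) (?N x)" by (auto simp: inj_on_def doubleton_eq_iff)
    have sub: "(\<lambda>y. {x, y}) ` ?N x \<subseteq> {e \<in> E. x \<in> e}" by auto
    show ?thesis
      using d[OF True] inj_on_finite[OF inj sub] card_inj_on_le[OF inj sub] by auto
  next
    \<comment> \<open>Neighbourhoods have to be bounded on the whole type; outside V there are no
      edges.\<close>
    case False
    have "x \<in> V" if xy: "{x, y} \<in> E" for y
    proof -
      obtain u v where "u \<in> V" "v \<in> V" "{x, y} = {u, v}"
        using assms(1) xy unfolding simple_graph_def by blast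
      then show ?thesis by (auto simp: doubleton_eq_iff)
    qed
    then have "?N x = {}" using False by blast
    then show ?thesis by simp
  qed
  \<comment> \<open>The summand 1 only ensures that the bound is positive, as
    \<open>bounded_degree_graph\<close> demands.\<close>
  have "card (?N x \<union> (\<Union>z\<in>?N x. ?N z)) \<le> d + d * d + 1" for x
  proof -
    have "card (\<Union>z\<in>?N x. ?N z) \<le> (\<Sum>z\<in>?N x. card (?N z))" using N by (intro card_UN_le) auto
    also have "\<dots> \<le> (\<Sum>z\<in>?N x. d)" using N by (intro sum_mono) auto
    also have "\<dots> \<le> d * d" using N[of x] by simp
    finally show ?thesis using card_Un_le[of "?N x" "\<Union>z\<in>?N x. ?N z"] N[of x] by linarith
  qed
  then have "bounded_degree_graph (\<lambda>x. ?N x \<union> (\<Union>z\<in>?N x. ?N z)) (d + d * d + 1)"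
    using N by unfold_locales (auto simp: insert_commute)
  then show ?thesis by (rule that)
qed

theorem proposition5p1:
  fixes V :: "'a set" and E :: "'a set set"
  assumes "simple_graph V E" and "infinite V" and "connected_graph V E" and "bounded_degree V E"
  shows "\<exists>k>0. \<exists>c. proper_edge_coloring E k c \<and>
           (\<forall>x\<in>V. \<forall>M. M \<subseteq> orbit_closure V E k c x \<and>
              minimal_subsystem (Gamma_group k) (Sch_topology k) sch_act M \<longrightarrow>
              generic_URS (Gamma_group k) {H \<in> Sub (Gamma_group k). SchreierMap k H \<in> M})"
proof -
  obtain D where
    "bounded_degree_graph (\<lambda>x. {y. {x, y} \<in> E} \<union> (\<Union>z\<in>{z. {x, z} \<in> E}. {y. {z, y} \<in> E})) D"
    using square_bounded_degree[OF assms(1,4)] .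
  then interpret N2: bounded_degree_graph
    "\<lambda>x. {y. {x, y} \<in> E} \<union> (\<Union>z\<in>{z. {x, z} \<in> E}. {y. {z, y} \<in> E})" D .
  obtain f :: "'a \<Rightarrow> nat" where f: "range f \<subseteq> {..<N2.num_colors}"
      and nonrep: "\<And>p. N2.simple_path p \<Longrightarrow> \<not> repetitive f p"
    using N2.nonrepetitive_coloring by blast
  \<comment> \<open>Two vertices at distance one or two form a path of the square, and two equal
    colours would already be a repetition.\<close>
  have neq: "f x \<noteq> f y" if "x \<noteq> y" "{x, y} \<in> E \<or> (\<exists>z. {x, z} \<in> E \<and> {z, y} \<in> E)" for x y
  proof
    assume "f x = f y"
    then have "repetitive f [x, y]" unfolding repetitive_def by (intro exI[of _ "[f x]"]) simp
    moreover have "N2.simple_path [x, y]" using that by (auto simp: N2.simple_path_def)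
    ultimately show False using nonrep by blast
  qed
  \<comment> \<open>The number of all sets of vertex colours: \<open>set_encode\<close> numbers
    them, and an edge uses the set of colours of its ends.\<close>
  let ?k = "2 ^ N2.num_colors :: nat"
  define c where "c e = set_encode (f ` e)" for e
  have finE: "finite e" if "e \<in> E" for e using assms(1) that unfolding simple_graph_def by auto
  have c_eq: "f ` e = f ` e'" if "e \<in> E" "e' \<in> E" "c e = c e'" for e e'
    using that finE by (simp add: c_def set_encode_eq)
  have nbrs: "f y \<noteq> f z" if "{x, y} \<in> E" "{x, z} \<in> E" "y \<noteq> z" for x y z
    using neq[of y z] that by (auto simp: insert_commute)
  have proper: "proper_edge_coloring E ?k c"
    unfolding proper_edge_coloring_def
  proof (intro conjI ballI impI)
    show "c ` E \<subseteq> {..<?k}" using f by (auto simp: c_def intro!: set_encode_less)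
    fix e e' assume e: "e \<in> E" "e' \<in> E" and ne: "e \<noteq> e' \<and> e \<inter> e' \<noteq> {}"
    then obtain x where x: "x \<in> e" "x \<in> e'" by blast
    have "\<exists>y. a = {x, y}" if a: "a \<in> E" "x \<in> a" for a
    proof -
      obtain u v where uv: "a = {u, v}" using assms(1) a(1) unfolding simple_graph_def by blast
      then have "a = {x, u} \<or> a = {x, v}" using a(2) by auto
      then show ?thesis by blast
    qed
    then obtain y z where yz: "e = {x, y}" "e' = {x, z}" using e x by meson
    then have "f y \<noteq> f z" using e ne by (intro nbrs[of x]) auto
    then have "f ` e \<noteq> f ` e'" using yz by (auto simp: doubleton_eq_iff)
    then show "c e \<noteq> c e'" using c_eq[OF e] by blast
  qed
  interpret nonrepetitive_edge_coloring V E ?k c f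
  proof
    fix p :: "'a list" assume p: "distinct p" "successively (\<lambda>x y. {x, y} \<in> E) p"
    \<comment> \<open>A path of G is in particular a path of its square.\<close>
    have "N2.simple_path p" unfolding N2.simple_path_def
      using p(1) successively_mono[OF p(2)] by simp
    then show "\<not> repetitive f p" by (rule nonrep)
  qed (fact assms proper c_eq nbrs)+
  have "?k > 0" by simp
  then show ?thesis using proper generic by blast
qed

end
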